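(* Let $G$ be a $2n$-dimensional Lie group with Lie algebra $\mathfrak{g}$ admitting a left invariant anti-Kähler structure $(g,J)$ with $J$ an abelian complex structure, i.e. $[JX,JY]=[X,Y]$ for all $X,Y\in\mathfrak{g}$. Then $\mathfrak{g}$ is a unimodular Lie algebra, i.e. $\operatorname{Tr}(\operatorname{ad}_X)=0$ for all $X\in\mathfrak{g}$.
   Context: The Lie algebra $\mathfrak{g}$ of $G$ is the space of left invariant vector fields on $G$. A left invariant anti-Kähler structure on $G$ is a pair $(g,J)$ where $g$ is a left invariant pseudo-Riemannian metric on $G$, $J$ is a left invariant almost complex structure on $G$ (so $J$ maps $\mathfrak{g}$ to $\mathfrak{g}$ and $J^2=-\mathrm{Id}$), $g(JX,JY)=-g(X,Y)$ for all $X,Y$, and $\nabla J=0$ where $\nabla$ is the Levi-Civita connection of $g$. *)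

theory Defs
  imports "HOL-Analysis.Analysis" "HOL-Algebra.Group" "HOL-Library.Function_Algebras"
begin

text \<open>
  Pointwise real vector space structure on functions. Tangent vectors act on real-valued functions
  and vector fields send points to tangent vectors, so both are function types, to which the
  library's \<^const>\<open>subspace\<close>, \<^const>\<open>span\<close> and \<^const>\<open>representation\<close> then apply.
\<close>

instantiation "fun" :: (type, real_vector) real_vector
begin

definition scaleR_fun :: "real \<Rightarrow> ('a \<Rightarrow> 'b) \<Rightarrow> 'a \<Rightarrow> 'b"
  where "scaleR_fun c f = (\<lambda>x. c *\<^sub>R f x)"

instance
  by standard (simp_all add: scaleR_fun_def fun_eq_iff scaleR_add_right scaleR_add_left)

end

text \<open>
  Trace of an endomorphism of a finite-dimensional subspace \<open>V\<close>, computed in some basis of \<open>V\<close>;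
  the value does not depend on which one. (If \<open>V\<close> is infinite-dimensional the sum is 0.)
\<close>

definition trace_on :: "'v::real_vector set \<Rightarrow> ('v \<Rightarrow> 'v) \<Rightarrow> real"
  where "trace_on V F =
    (let B = (SOME B. B \<subseteq> V \<and> independent B \<and> V \<subseteq> span B)
     in \<Sum>b\<in>B. representation B (F b) b)"


section \<open>Lie groups\<close>

text \<open>All uses of the following two notions are on open subsets of a Euclidean space.\<close>

primrec Ck_on :: "nat \<Rightarrow> 'u::real_normed_vector set \<Rightarrow> ('u \<Rightarrow> 'v::real_normed_vector) \<Rightarrow> bool"
  where
    "Ck_on 0 S f \<longleftrightarrow> continuous_on S f"
  | "Ck_on (Suc k) S f \<longleftrightarrow>
      (\<forall>x\<in>S. f differentiable at x) \<and> (\<forall>v. Ck_on k S (\<lambda>x. frechet_derivative f (at x) v))"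

definition Cinf_on :: "'u::real_normed_vector set \<Rightarrow> ('u \<Rightarrow> 'v::real_normed_vector) \<Rightarrow> bool"
  where "Cinf_on S f \<longleftrightarrow> (\<forall>k. Ck_on k S f)"

text \<open>
  A group together with a topology and an atlas on its carrier. A chart is a pair \<open>(U, \<phi>)\<close>, where
  only the values of \<open>\<phi>\<close> on \<open>U\<close> matter; its inverse is \<open>inv_into U \<phi>\<close>.
\<close>

record ('a, 'e) charted_group = "'a monoid" +
  top_of :: "'a topology"
  atlas :: "('a set \<times> ('a \<Rightarrow> 'e)) set"

definition smooth_manifold :: "('a, 'e::euclidean_space) charted_group \<Rightarrow> bool"
  where "smooth_manifold G \<longleftrightarrow>
    topspace (top_of G) = carrier G \<and> Hausdorff_space (top_of G) \<and> second_countable (top_of G) \<and>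
    (\<Union>(U, \<phi>)\<in>atlas G. U) = carrier G \<and>
    (\<forall>(U, \<phi>)\<in>atlas G. openin (top_of G) U \<and> open (\<phi> ` U) \<and>
       homeomorphic_map (subtopology (top_of G) U) (top_of_set (\<phi> ` U)) \<phi>) \<and>
    (\<forall>(U, \<phi>)\<in>atlas G. \<forall>(V, \<psi>)\<in>atlas G. Cinf_on (\<phi> ` (U \<inter> V)) (\<psi> \<circ> inv_into U \<phi>))"

definition smooth_mult :: "('a, 'e::euclidean_space) charted_group \<Rightarrow> bool"
  where "smooth_mult G \<longleftrightarrow>
    continuous_map (prod_topology (top_of G) (top_of G)) (top_of G) (\<lambda>(a, b). a \<otimes>\<^bsub>G\<^esub> b) \<and>
    (\<forall>(U, \<phi>)\<in>atlas G. \<forall>(V, \<psi>)\<in>atlas G. \<forall>(W, \<eta>)\<in>atlas G.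
       Cinf_on {(x, y). x \<in> \<phi> ` U \<and> y \<in> \<psi> ` V \<and> inv_into U \<phi> x \<otimes>\<^bsub>G\<^esub> inv_into V \<psi> y \<in> W}
         (\<lambda>(x, y). \<eta> (inv_into U \<phi> x \<otimes>\<^bsub>G\<^esub> inv_into V \<psi> y)))"

definition smooth_inverse :: "('a, 'e::euclidean_space) charted_group \<Rightarrow> bool"
  where "smooth_inverse G \<longleftrightarrow>
    continuous_map (top_of G) (top_of G) (\<lambda>a. inv\<^bsub>G\<^esub> a) \<and>
    (\<forall>(U, \<phi>)\<in>atlas G. \<forall>(W, \<eta>)\<in>atlas G.
       Cinf_on {x \<in> \<phi> ` U. inv\<^bsub>G\<^esub> (inv_into U \<phi> x) \<in> W} (\<lambda>x. \<eta> (inv\<^bsub>G\<^esub> (inv_into U \<phi> x))))"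

text \<open>The dimension of the Lie group is \<open>DIM('e)\<close>.\<close>

definition lie_group :: "('a, 'e::euclidean_space) charted_group \<Rightarrow> bool"
  where "lie_group G \<longleftrightarrow> group G \<and> smooth_manifold G \<and> smooth_mult G \<and> smooth_inverse G"


section \<open>Tangent vectors and vector fields\<close>

text \<open>Smoothness on an open set \<open>U\<close>, and on some neighbourhood of \<open>p\<close>.\<close>

definition smooth_fun :: "('a, 'e::euclidean_space) charted_group \<Rightarrow> 'a set \<Rightarrow> ('a \<Rightarrow> real) \<Rightarrow> bool"
  where "smooth_fun G U f \<longleftrightarrow>
    (\<forall>(V, \<phi>)\<in>atlas G. Cinf_on (\<phi> ` (U \<inter> V)) (f \<circ> inv_into V \<phi>))"

definition smooth_near :: "('a, 'e::euclidean_space) charted_group \<Rightarrow> 'a \<Rightarrow> ('a \<Rightarrow> real) \<Rightarrow> bool"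
  where "smooth_near G p f \<longleftrightarrow> (\<exists>U. openin (top_of G) U \<and> p \<in> U \<and> smooth_fun G U f)"

text \<open>
  The tangent space at \<open>p\<close>: derivations at \<open>p\<close> of the functions that are smooth near \<open>p\<close>. Such a
  derivation only depends on germs: if \<open>f\<close> vanishes on a neighbourhood \<open>W\<close> of \<open>p\<close>, then
  \<open>f * indicator W = 0\<close>, and the Leibniz rule gives \<open>v f = 0\<close>. On the remaining functions the value
  is fixed to be 0, so that equality of tangent vectors is equality of derivations.
\<close>

type_synonym 'a tangent_vector = "('a \<Rightarrow> real) \<Rightarrow> real"
type_synonym 'a vector_field = "'a \<Rightarrow> 'a tangent_vector"

definition tangent_space ::
    "('a, 'e::euclidean_space) charted_group \<Rightarrow> 'a \<Rightarrow> 'a tangent_vector set"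
  where "tangent_space G p = {v.
    (\<forall>f h. smooth_near G p f \<longrightarrow> smooth_near G p h \<longrightarrow>
       v (f + h) = v f + v h \<and> v (f * h) = f p * v h + h p * v f) \<and>
    (\<forall>f c. smooth_near G p f \<longrightarrow> v (c *\<^sub>R f) = c * v f) \<and>
    (\<forall>f. \<not> smooth_near G p f \<longrightarrow> v f = 0)}"

definition vector_fields :: "('a, 'e::euclidean_space) charted_group \<Rightarrow> 'a vector_field set"
  where "vector_fields G = {X.
    (\<forall>p\<in>carrier G. X p \<in> tangent_space G p) \<and>
    (\<forall>p. p \<notin> carrier G \<longrightarrow> X p = 0) \<and>
    (\<forall>U f. openin (top_of G) U \<longrightarrow> smooth_fun G U f \<longrightarrow> smooth_fun G U (\<lambda>p. X p f))}"

definition lie_bracket ::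
    "('a, 'e::euclidean_space) charted_group \<Rightarrow> 'a vector_field \<Rightarrow> 'a vector_field \<Rightarrow> 'a vector_field"
  where "lie_bracket G X Y = (\<lambda>p f.
    if p \<in> carrier G \<and> smooth_near G p f then X p (\<lambda>q. Y q f) - Y p (\<lambda>q. X q f) else 0)"

text \<open>
  Differential of the left translation by \<open>a\<close>, as a map from the tangent space at \<open>p\<close> to the one
  at \<open>a \<otimes>\<^bsub>G\<^esub> p\<close>; the formula does not depend on \<open>p\<close>.
\<close>

definition left_push ::
    "('a, 'e::euclidean_space) charted_group \<Rightarrow> 'a \<Rightarrow> 'a tangent_vector \<Rightarrow> 'a tangent_vector"
  where "left_push G a v = (\<lambda>f. v (\<lambda>x. f (a \<otimes>\<^bsub>G\<^esub> x)))"

definition lie_algebra :: "('a, 'e::euclidean_space) charted_group \<Rightarrow> 'a vector_field set"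
  where "lie_algebra G = {X \<in> vector_fields G.
    \<forall>a\<in>carrier G. \<forall>p\<in>carrier G. X (a \<otimes>\<^bsub>G\<^esub> p) = left_push G a (X p)}"

definition unimodular :: "('a, 'e::euclidean_space) charted_group \<Rightarrow> bool"
  where "unimodular G \<longleftrightarrow> (\<forall>X\<in>lie_algebra G. trace_on (lie_algebra G) (lie_bracket G X) = 0)"


section \<open>Left invariant anti-Kaehler structures\<close>

type_synonym 'a metric_tensor = "'a \<Rightarrow> 'a tangent_vector \<Rightarrow> 'a tangent_vector \<Rightarrow> real"
type_synonym 'a endo_field = "'a \<Rightarrow> 'a tangent_vector \<Rightarrow> 'a tangent_vector"

text \<open>
  Symmetry and linearity in the first argument give bilinearity. The signature is not fixed; it is
  locally constant by continuity.
\<close>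

definition pseudo_riemannian ::
    "('a, 'e::euclidean_space) charted_group \<Rightarrow> 'a metric_tensor \<Rightarrow> bool"
  where "pseudo_riemannian G g \<longleftrightarrow>
    (\<forall>p\<in>carrier G.
      (\<forall>u\<in>tangent_space G p. \<forall>v\<in>tangent_space G p. g p u v = g p v u) \<and>
      (\<forall>u\<in>tangent_space G p. \<forall>v\<in>tangent_space G p. \<forall>w\<in>tangent_space G p.
         g p (u + v) w = g p u w + g p v w) \<and>
      (\<forall>c. \<forall>u\<in>tangent_space G p. \<forall>w\<in>tangent_space G p. g p (c *\<^sub>R u) w = c * g p u w) \<and>
      (\<forall>u\<in>tangent_space G p. (\<forall>w\<in>tangent_space G p. g p u w = 0) \<longrightarrow> u = 0)) \<and>
    (\<forall>X\<in>vector_fields G. \<forall>Y\<in>vector_fields G. smooth_fun G (carrier G) (\<lambda>p. g p (X p) (Y p)))"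

definition left_invariant_metric ::
    "('a, 'e::euclidean_space) charted_group \<Rightarrow> 'a metric_tensor \<Rightarrow> bool"
  where "left_invariant_metric G g \<longleftrightarrow>
    (\<forall>a\<in>carrier G. \<forall>p\<in>carrier G. \<forall>u\<in>tangent_space G p. \<forall>v\<in>tangent_space G p.
       g (a \<otimes>\<^bsub>G\<^esub> p) (left_push G a u) (left_push G a v) = g p u v)"

definition apply_endo ::
    "('a, 'e::euclidean_space) charted_group \<Rightarrow> 'a endo_field \<Rightarrow> 'a vector_field \<Rightarrow> 'a vector_field"
  where "apply_endo G J X = (\<lambda>p. if p \<in> carrier G then J p (X p) else 0)"

definition almost_complex ::
    "('a, 'e::euclidean_space) charted_group \<Rightarrow> 'a endo_field \<Rightarrow> bool"
  where "almost_complex G J \<longleftrightarrow>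
    (\<forall>p\<in>carrier G.
      (\<forall>u\<in>tangent_space G p. J p u \<in> tangent_space G p \<and> J p (J p u) = - u) \<and>
      (\<forall>u\<in>tangent_space G p. \<forall>v\<in>tangent_space G p. J p (u + v) = J p u + J p v) \<and>
      (\<forall>c. \<forall>u\<in>tangent_space G p. J p (c *\<^sub>R u) = c *\<^sub>R J p u)) \<and>
    (\<forall>X\<in>vector_fields G. apply_endo G J X \<in> vector_fields G)"

definition left_invariant_endo ::
    "('a, 'e::euclidean_space) charted_group \<Rightarrow> 'a endo_field \<Rightarrow> bool"
  where "left_invariant_endo G J \<longleftrightarrow>
    (\<forall>a\<in>carrier G. \<forall>p\<in>carrier G. \<forall>u\<in>tangent_space G p.
       J (a \<otimes>\<^bsub>G\<^esub> p) (left_push G a u) = left_push G a (J p u))"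

definition affine_connection ::
    "('a, 'e::euclidean_space) charted_group \<Rightarrow>
     ('a vector_field \<Rightarrow> 'a vector_field \<Rightarrow> 'a vector_field) \<Rightarrow> bool"
  where "affine_connection G D \<longleftrightarrow>
    (\<forall>X\<in>vector_fields G. \<forall>Y\<in>vector_fields G. D X Y \<in> vector_fields G) \<and>
    (\<forall>X\<in>vector_fields G. \<forall>Y\<in>vector_fields G. \<forall>Z\<in>vector_fields G.
       D (X + Y) Z = D X Z + D Y Z \<and> D X (Y + Z) = D X Y + D X Z) \<and>
    (\<forall>h. smooth_fun G (carrier G) h \<longrightarrow> (\<forall>X\<in>vector_fields G. \<forall>Y\<in>vector_fields G.
       D (\<lambda>p. h p *\<^sub>R X p) Y = (\<lambda>p. h p *\<^sub>R D X Y p) \<and>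
       D X (\<lambda>p. h p *\<^sub>R Y p) = (\<lambda>p. X p h *\<^sub>R Y p + h p *\<^sub>R D X Y p)))"

definition levi_civita ::
    "('a, 'e::euclidean_space) charted_group \<Rightarrow> 'a metric_tensor \<Rightarrow>
     ('a vector_field \<Rightarrow> 'a vector_field \<Rightarrow> 'a vector_field) \<Rightarrow> bool"
  where "levi_civita G g D \<longleftrightarrow> affine_connection G D \<and>
    (\<forall>X\<in>vector_fields G. \<forall>Y\<in>vector_fields G. D X Y - D Y X = lie_bracket G X Y) \<and>
    (\<forall>X\<in>vector_fields G. \<forall>Y\<in>vector_fields G. \<forall>Z\<in>vector_fields G. \<forall>p\<in>carrier G.
       X p (\<lambda>q. g q (Y q) (Z q)) = g p (D X Y p) (Z p) + g p (Y p) (D X Z p))"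

text \<open>\<open>\<nabla>J = 0\<close>, where \<open>(\<nabla>\<^sub>X J) Y = \<nabla>\<^sub>X (J Y) - J (\<nabla>\<^sub>X Y)\<close>.\<close>

definition parallel_endo ::
    "('a, 'e::euclidean_space) charted_group \<Rightarrow>
     ('a vector_field \<Rightarrow> 'a vector_field \<Rightarrow> 'a vector_field) \<Rightarrow> 'a endo_field \<Rightarrow> bool"
  where "parallel_endo G D J \<longleftrightarrow>
    (\<forall>X\<in>vector_fields G. \<forall>Y\<in>vector_fields G. D X (apply_endo G J Y) - apply_endo G J (D X Y) = 0)"

text \<open>
  By the fundamental theorem of pseudo-Riemannian geometry there is exactly one Levi-Civita
  connection on vector fields of \<open>G\<close>, so the existential quantifier below merely names it.
\<close>

definition left_invariant_anti_kaehler ::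
    "('a, 'e::euclidean_space) charted_group \<Rightarrow> 'a metric_tensor \<Rightarrow> 'a endo_field \<Rightarrow> bool"
  where "left_invariant_anti_kaehler G g J \<longleftrightarrow>
    pseudo_riemannian G g \<and> left_invariant_metric G g \<and>
    almost_complex G J \<and> left_invariant_endo G J \<and>
    (\<forall>p\<in>carrier G. \<forall>u\<in>tangent_space G p. \<forall>v\<in>tangent_space G p. g p (J p u) (J p v) = - g p u v) \<and>
    (\<exists>D. levi_civita G g D \<and> parallel_endo G D J)"

text \<open>An abelian almost complex structure is automatically integrable.\<close>

definition abelian_complex ::
    "('a, 'e::euclidean_space) charted_group \<Rightarrow> 'a endo_field \<Rightarrow> bool"
  where "abelian_complex G J \<longleftrightarrow>
    (\<forall>X\<in>lie_algebra G. \<forall>Y\<in>lie_algebra G.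
       lie_bracket G (apply_endo G J X) (apply_endo G J Y) = lie_bracket G X Y)"

end

theory Submission
  imports Defs
begin

text \<open>
  Let \<open>J\<close> be abelian and parallel. Then \<open>A(X, Y) = \<nabla>\<^sub>X Y - J \<nabla>\<^bsub>JX\<^esub> Y\<close> is symmetric in \<open>X\<close> and \<open>Y\<close>,
  while \<open>A(X, -)\<close> is skew-adjoint for \<open>g\<close>, because \<open>J\<close> is self-adjoint and commutes with \<open>\<nabla>\<close>. A
  trilinear form that is symmetric in the first two and skew in the last two arguments vanishes, so
  \<open>\<nabla>\<^bsub>JX\<^esub> = - J \<nabla>\<^sub>X\<close>. Now \<open>ad\<^sub>X = \<nabla>\<^sub>X - (Y \<mapsto> \<nabla>\<^sub>Y X)\<close>, where the first summand is skew-adjoint and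
  the second anticommutes with \<open>J\<close>; both have trace 0.

  This needs \<open>g\<close> to be nondegenerate on left invariant fields, i.e. that every tangent vector at the
  identity extends to a smooth left invariant field. By Hadamard's lemma a derivation is a
  combination of partial derivatives in a chart, which gives the smoothness of the extension.
\<close>

section \<open>Smooth maps between Euclidean spaces\<close>

text \<open>The sign in \<open>g(JX, JY) = -g(X, Y)\<close> carries the argument: it makes
  \<open>J\<close> self-adjoint, so the summand \<open>J \<nabla>_{JX}\<close> of
  \<open>A(X, -)\<close> is skew-adjoint on left invariant fields. For a Hermitian metric
  \<open>J\<close> would be skew-adjoint and the same summand self-adjoint. The obstacle is that
  tangent vectors are abstract derivations and that the connection \<open>D\<close> is given only as
  an operation on global smooth fields, so \<open>D X Y\<close> is not visibly left invariant. The
  algebra is therefore separated from the manifold: it is done for a product \<open>N\<close> on a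
  subspace of an arbitrary real vector space, and \<open>N X Y\<close> is later taken to be the left
  invariant field that agrees with \<open>D X Y\<close> at the identity. Left invariant fields are
  equal once they agree at the identity, so the properties of \<open>D\<close> at this single point
  can be transferred to \<open>N\<close>.\<close>

lemma Ck_on_SucD:
  assumes "Ck_on (Suc k) S f" "x \<in> S"
  shows "(f has_derivative frechet_derivative f (at x)) (at x)"
  using assms by (simp add: frechet_derivative_works)

text \<open>Openness matters because derivatives are taken \<open>at x\<close> in the whole space:
  agreement on a full neighbourhood of \<open>x\<close> is what transfers them.\<close>

lemma Ck_on_cong:
  assumes "open S" "\<And>x. x \<in> S \<Longrightarrow> f x = g x" "Ck_on k S f"
  shows "Ck_on k S g"
  using assms(2,3)
proof (induction k arbitrary: f g)
  case 0
  then show ?case using continuous_on_cong[of S S f g] by simp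
next
  case (Suc k)
  have d: "(g has_derivative frechet_derivative f (at x)) (at x)" if "x \<in> S" for x
    using has_derivative_transform_within_open[OF Ck_on_SucD[OF Suc.prems(2) that] assms(1) that]
      Suc.prems(1) by auto
  have "Ck_on k S (\<lambda>x. frechet_derivative g (at x) v)" for v
    by (rule Suc.IH[of "\<lambda>x. frechet_derivative f (at x) v"])
      (use frechet_derivative_at[OF d] Suc.prems(2) in auto)
  then show ?case using d by (auto simp: differentiable_def)
qed

text \<open>Derivatives are unique, so an explicit formula may stand in for the chosen
  \<open>frechet_derivative\<close>. The rules for sums, products, pairs, composites and integrals
  enter their induction step through this one.\<close>

lemma Ck_on_SucI:
  assumes "open S" "\<And>x. x \<in> S \<Longrightarrow> (f has_derivative f' x) (at x)"
    and "\<And>v. Ck_on k S (\<lambda>x. f' x v)"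
  shows "Ck_on (Suc k) S f"
proof -
  have "Ck_on k S (\<lambda>x. frechet_derivative f (at x) v)" for v
    by (rule Ck_on_cong[OF assms(1) _ assms(3)[of v]])
      (use frechet_derivative_at[OF assms(2)] in auto)
  then show ?thesis using assms(2) by (auto simp: differentiable_def)
qed

lemma Ck_on_subset:
  assumes "Ck_on k S f" "T \<subseteq> S"
  shows "Ck_on k T f"
  using assms by (induction k arbitrary: f) (auto intro: continuous_on_subset)

lemma Ck_on_SucD':
  assumes "Ck_on (Suc k) S f"
  shows "Ck_on k S f"
  using assms
proof (induction k arbitrary: f)
  case 0
  then show ?case
    by (auto intro!: continuous_at_imp_continuous_on differentiable_imp_continuous_within)
next
  case (Suc k)
  have "\<forall>v. Ck_on k S (\<lambda>x. frechet_derivative f (at x) v)"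
    using Suc.IH Suc.prems by (metis Ck_on.simps(2))
  then show ?case using Suc.prems by auto
qed

text \<open>Continuity and differentiability at a point see only a neighbourhood. This is what lets
  the target chart vary from point to point when group multiplication is treated.\<close>

lemma Ck_on_local:
  assumes "\<And>x. x \<in> S \<Longrightarrow> \<exists>T. open T \<and> x \<in> T \<and> Ck_on k T f"
  shows "Ck_on k S f"
  using assms
proof (induction k arbitrary: f)
  case 0
  have "isCont f x" if "x \<in> S" for x
    using 0[OF that] by (auto simp: continuous_on_eq_continuous_at)
  then show ?case by (simp add: continuous_at_imp_continuous_on)
next
  case (Suc k)
  have "f differentiable at x" if "x \<in> S" for x
    using Suc.prems[OF that] by auto
  moreover have "Ck_on k S (\<lambda>x. frechet_derivative f (at x) v)" for v
    using Suc.prems by (intro Suc.IH) fastforce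
  ultimately show ?case by simp
qed

lemma Ck_on_const: "Ck_on k S (\<lambda>x. c)"
proof (induction k arbitrary: c)
  case (Suc k)
  then show ?case by simp
qed simp

lemma Ck_on_bounded_linear:
  assumes "open S" "bounded_linear L"
  shows "Ck_on k S L"
proof (cases k)
  case 0
  then show ?thesis using assms by (simp add: linear_continuous_on)
next
  case (Suc j)
  then show ?thesis
    using Ck_on_SucI[OF assms(1), of L "\<lambda>_. L"] assms(2)
    by (simp add: bounded_linear_imp_has_derivative Ck_on_const del: Ck_on.simps)
qed

lemma Ck_on_add:
  assumes "open S" "Ck_on k S f" "Ck_on k S g"
  shows "Ck_on k S (\<lambda>x. f x + g x)"
  using assms(2,3)
proof (induction k arbitrary: f g)
  case 0
  then show ?case by (simp add: continuous_on_add)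
next
  case (Suc k)
  show ?case
  proof (rule Ck_on_SucI[OF assms(1)])
    show "((\<lambda>x. f x + g x) has_derivative
        (\<lambda>v. frechet_derivative f (at x) v + frechet_derivative g (at x) v)) (at x)" if "x \<in> S" for x
      using that Suc.prems by (intro has_derivative_add Ck_on_SucD)
  qed (use Suc in auto)
qed

text \<open>By the Leibniz rule the derivative is a sum of two values of \<open>P\<close> in which
  one factor has been differentiated, so the induction has to range over all pairs \<open>f\<close>,
  \<open>g\<close>.\<close>

lemma Ck_on_bilinear:
  assumes "open S" "bounded_bilinear P" "Ck_on k S f" "Ck_on k S g"
  shows "Ck_on k S (\<lambda>x. P (f x) (g x))"
  using assms(3,4)
proof (induction k arbitrary: f g)
  case 0
  then show ?case using bounded_bilinear.continuous_on[OF assms(2)] by simp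
next
  case (Suc k)
  note D = Suc.prems[THEN Ck_on_SucD']
  show ?case
  proof (rule Ck_on_SucI[OF assms(1)])
    show "((\<lambda>x. P (f x) (g x)) has_derivative
        (\<lambda>v. P (f x) (frechet_derivative g (at x) v) + P (frechet_derivative f (at x) v) (g x))) (at x)"
      if "x \<in> S" for x
      using that Suc.prems by (intro bounded_bilinear.FDERIV[OF assms(2)] Ck_on_SucD)
    show "Ck_on k S (\<lambda>x. P (f x) (frechet_derivative g (at x) v) + P (frechet_derivative f (at x) v) (g x))"
      for v
      using Suc.prems D by (intro Ck_on_add[OF assms(1)] Suc.IH) auto
  qed
qed

lemma Ck_on_sum:
  assumes "open S" "\<And>i. i \<in> I \<Longrightarrow> Ck_on k S (f i)"
  shows "Ck_on k S (\<lambda>x. \<Sum>i\<in>I. f i x)"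
  using assms(2) by (induction I rule: infinite_finite_induct) (auto intro: Ck_on_const Ck_on_add[OF assms(1)])

lemma Ck_on_Pair:
  assumes "open S" "Ck_on k S f" "Ck_on k S g"
  shows "Ck_on k S (\<lambda>x. (f x, g x))"
  using assms(2,3)
proof (induction k arbitrary: f g)
  case 0
  then show ?case by (simp add: continuous_on_Pair)
next
  case (Suc k)
  show ?case
  proof (rule Ck_on_SucI[OF assms(1)])
    show "((\<lambda>x. (f x, g x)) has_derivative
        (\<lambda>v. (frechet_derivative f (at x) v, frechet_derivative g (at x) v))) (at x)" if "x \<in> S" for x
      using that Suc.prems by (intro has_derivative_Pair Ck_on_SucD)
  qed (use Suc in auto)
qed

text \<open>The chain rule yields \<open>Df (g x) (Dg x v)\<close>, whose direction moves with
  \<open>x\<close>, whereas \<open>Ck_on\<close> controls derivatives in fixed directions. Expanding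
  \<open>Dg x v\<close> in the finite basis of the middle space leaves scalars times derivatives of
  \<open>f\<close> in fixed directions.\<close>

lemma Ck_on_compose:
  fixes g :: "'u::real_normed_vector \<Rightarrow> 'v::euclidean_space"
  assumes "open S" "open T" "\<And>x. x \<in> S \<Longrightarrow> g x \<in> T" "Ck_on k S g" "Ck_on k T f"
  shows "Ck_on k S (\<lambda>x. f (g x))"
  using assms(4,5)
proof (induction k arbitrary: f)
  case 0
  then show ?case using assms(3) by (auto intro: continuous_on_compose2)
next
  case (Suc k)
  let ?f = "\<lambda>y. frechet_derivative f (at y)" and ?g = "\<lambda>x. frechet_derivative g (at x)"
  show ?case
  proof (rule Ck_on_SucI[OF assms(1)])
    fix x assume x: "x \<in> S"
    have df: "(f has_derivative ?f (g x)) (at (g x))"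
      using Ck_on_SucD[OF Suc.prems(2)] assms(3)[OF x] .
    interpret f: bounded_linear "?f (g x)" using df by (rule has_derivative_bounded_linear)
    have "?f (g x) (?g x v) = (\<Sum>b\<in>Basis. (?g x v \<bullet> b) *\<^sub>R ?f (g x) b)" for v
      by (subst euclidean_representation[symmetric, of "?g x v"], subst f.sum) (simp add: f.scaleR)
    then show "((\<lambda>x. f (g x)) has_derivative (\<lambda>v. \<Sum>b\<in>Basis. (?g x v \<bullet> b) *\<^sub>R ?f (g x) b)) (at x)"
      using has_derivative_compose[OF Ck_on_SucD[OF Suc.prems(1) x] df] by simp
  next
    fix v
    have g: "Ck_on k S g" by (rule Ck_on_SucD'[OF Suc.prems(1)])
    show "Ck_on k S (\<lambda>x. \<Sum>b\<in>Basis. (?g x v \<bullet> b) *\<^sub>R ?f (g x) b)"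
    proof (intro Ck_on_sum Ck_on_bilinear[OF assms(1) bounded_bilinear_scaleR]
        Ck_on_bilinear[OF assms(1) bounded_bilinear_inner] Ck_on_const assms(1))
      show "Ck_on k S (\<lambda>x. ?f (g x) b)" for b
        using Suc.prems(2) by (intro Suc.IH[OF g]) auto
    qed (use Suc.prems in auto)
  qed
qed

lemma Cinf_on_frechet_derivative:
  "Cinf_on S f \<Longrightarrow> Cinf_on S (\<lambda>x. frechet_derivative f (at x) v)"
  unfolding Cinf_on_def by (metis Ck_on.simps(2))

lemma Cinf_on_has_derivative:
  "Cinf_on S f \<Longrightarrow> x \<in> S \<Longrightarrow> (f has_derivative frechet_derivative f (at x)) (at x)"
  unfolding Cinf_on_def by (metis Ck_on_SucD)

lemma Cinf_on_subset: "Cinf_on S f \<Longrightarrow> T \<subseteq> S \<Longrightarrow> Cinf_on T f"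
  unfolding Cinf_on_def by (metis Ck_on_subset)

lemma Cinf_on_cong:
  "open S \<Longrightarrow> (\<And>x. x \<in> S \<Longrightarrow> f x = g x) \<Longrightarrow> Cinf_on S f \<Longrightarrow> Cinf_on S g"
  unfolding Cinf_on_def by (metis Ck_on_cong)

lemma Cinf_on_local:
  "(\<And>x. x \<in> S \<Longrightarrow> \<exists>T. open T \<and> x \<in> T \<and> Cinf_on T f) \<Longrightarrow> Cinf_on S f"
  unfolding Cinf_on_def by (metis Ck_on_local)

lemma Cinf_on_const: "Cinf_on S (\<lambda>x. c)"
  by (simp add: Cinf_on_def Ck_on_const)

lemma Cinf_on_bounded_linear: "open S \<Longrightarrow> bounded_linear L \<Longrightarrow> Cinf_on S L"
  by (simp add: Cinf_on_def Ck_on_bounded_linear)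

lemma Cinf_on_ident: "open S \<Longrightarrow> Cinf_on S (\<lambda>x. x)"
  by (rule Cinf_on_bounded_linear) (auto intro: bounded_linear_ident)

lemma Cinf_on_add: "open S \<Longrightarrow> Cinf_on S f \<Longrightarrow> Cinf_on S g \<Longrightarrow> Cinf_on S (\<lambda>x. f x + g x)"
  by (simp add: Cinf_on_def Ck_on_add)

lemma Cinf_on_bilinear:
  "open S \<Longrightarrow> bounded_bilinear P \<Longrightarrow> Cinf_on S f \<Longrightarrow> Cinf_on S g \<Longrightarrow> Cinf_on S (\<lambda>x. P (f x) (g x))"
  by (simp add: Cinf_on_def Ck_on_bilinear)

lemmas Cinf_on_mult = Cinf_on_bilinear[OF _ bounded_bilinear_mult]
lemmas Cinf_on_scaleR = Cinf_on_bilinear[OF _ bounded_bilinear_scaleR]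
lemmas Cinf_on_inner = Cinf_on_bilinear[OF _ bounded_bilinear_inner]

lemma Cinf_on_sum:
  "open S \<Longrightarrow> (\<And>i. i \<in> I \<Longrightarrow> Cinf_on S (f i)) \<Longrightarrow> Cinf_on S (\<lambda>x. \<Sum>i\<in>I. f i x)"
  by (simp add: Cinf_on_def Ck_on_sum)

lemma Cinf_on_Pair: "open S \<Longrightarrow> Cinf_on S f \<Longrightarrow> Cinf_on S g \<Longrightarrow> Cinf_on S (\<lambda>x. (f x, g x))"
  by (simp add: Cinf_on_def Ck_on_Pair)

lemma Cinf_on_compose:
  fixes g :: "'u::real_normed_vector \<Rightarrow> 'v::euclidean_space"
  shows "open S \<Longrightarrow> open T \<Longrightarrow> (\<And>x. x \<in> S \<Longrightarrow> g x \<in> T) \<Longrightarrow> Cinf_on S g \<Longrightarrow> Cinf_on T f \<Longrightarrow>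
    Cinf_on S (\<lambda>x. f (g x))"
  unfolding Cinf_on_def using Ck_on_compose[of S T g _ f] by blast

section \<open>Parameter integrals and Hadamard's lemma\<close>

lemma Ck_on_integral:
  fixes F :: "'u::euclidean_space \<times> real \<Rightarrow> real"
  assumes S: "open S" "convex S" and T: "{0..1} \<subseteq> T" and F: "Ck_on k (S \<times> T) F"
  shows "Ck_on k S (\<lambda>x. integral {0..1} (\<lambda>t. F (x, t)))"
  using F
proof (induction k arbitrary: F)
  case 0
  then have "continuous_on (S \<times> cbox 0 1) (\<lambda>(x, t). F (x, t))"
    using T by (auto intro: continuous_on_subset)
  from integral_continuous_on_param[OF this] show ?case by simp
next
  case (Suc k)
  let ?F = "\<lambda>z. frechet_derivative F (at z)"
  \<comment> \<open>The derivative in the parameter alone: directions \<open>(v, 0)\<close> leave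
    \<open>t\<close> fixed. \<open>leibniz_rule\<close> expects it as an element of the normed space
    of bounded operators.\<close>
  define B where "B x t = Blinfun (\<lambda>v. ?F (x, t) (v, 0))" for x t
  have dF: "(F has_derivative ?F (x, t)) (at (x, t))" if "x \<in> S" "t \<in> cbox 0 1" for x t
    using that T by (intro Ck_on_SucD[OF Suc.prems]) auto
  have B: "blinfun_apply (B x t) v = ?F (x, t) (v, 0)" if "x \<in> S" "t \<in> cbox 0 1" for x t v
    unfolding B_def
    by (subst bounded_linear_Blinfun_apply)
      (auto intro!: bounded_linear_compose[OF has_derivative_bounded_linear[OF dF[OF that]]]
        bounded_linear_Pair bounded_linear_ident bounded_linear_zero)
  have pd: "((\<lambda>x. F (x, t)) has_derivative blinfun_apply (B x t)) (at x within S)"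
    if "x \<in> S" "t \<in> cbox 0 1" for x t
  proof -
    have "((\<lambda>x. (x, t)) has_derivative (\<lambda>v. (v, 0))) (at x within S)"
      by (auto intro!: derivative_eq_intros)
    from has_derivative_compose[OF this dF[OF that]] show ?thesis
      using B[OF that] by (metis (no_types, lifting) ext)
  qed
  have c: "continuous_on (S \<times> cbox 0 1) F"
    using Ck_on_SucD'[OF Suc.prems] T
    by (intro continuous_at_imp_continuous_on ballI) (use dF has_derivative_continuous in fastforce)
  have ck: "Ck_on k (S \<times> T) (\<lambda>z. ?F z v)" for v
    using Suc.prems by (metis Ck_on.simps(2))
  have ck0: "Ck_on 0 (S \<times> T) (\<lambda>z. ?F z v)" for v
    using ck[of v] by (induction k) (auto simp del: Ck_on.simps dest: Ck_on_SucD')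
  \<comment> \<open>The parameter space is finite-dimensional, so continuity in operator norm
    reduces to continuity in each basis direction.\<close>
  have cB: "continuous_on (S \<times> cbox 0 1) (\<lambda>(x, t). B x t)"
  proof (rule continuous_on_blinfun_componentwise)
    fix i :: 'u
    have "continuous_on (S \<times> cbox 0 1) (\<lambda>z. ?F z (i, 0))"
      using ck0[of "(i, 0)"] T by (auto intro: continuous_on_subset)
    then show "continuous_on (S \<times> cbox 0 1) (\<lambda>z. blinfun_apply (case z of (x, t) \<Rightarrow> B x t) i)"
      by (rule continuous_on_eq) (auto simp: B)
  qed
  have int: "(\<lambda>t. F (x, t)) integrable_on cbox 0 1" if "x \<in> S" for x
    by (intro integrable_continuous continuous_on_compose2[OF c] continuous_intros) (use that in auto)
  have intB: "(\<lambda>t. B x t) integrable_on cbox 0 1" if "x \<in> S" for x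
  proof -
    have "continuous_on (cbox 0 1) (\<lambda>t. (\<lambda>(x, t). B x t) (x, t))"
      by (intro continuous_on_compose2[OF cB] continuous_intros) (use that in auto)
    then show ?thesis using integrable_continuous[of 0 1 "B x"] by simp
  qed
  show ?case
  proof (rule Ck_on_SucI[OF S(1)])
    fix x assume x: "x \<in> S"
    have "((\<lambda>x. integral (cbox 0 1) (\<lambda>t. F (x, t))) has_derivative
        blinfun_apply (integral (cbox 0 1) (B x))) (at x within S)"
      by (rule leibniz_rule[OF pd int cB x S(2)])
    moreover have "blinfun_apply (integral (cbox 0 1) (B x))
        = (\<lambda>v. integral {0..1} (\<lambda>t. ?F (x, t) (v, 0)))"
    proof
      fix v
      have "blinfun_apply (integral (cbox 0 1) (B x)) v
          = integral (cbox 0 1) (\<lambda>t. blinfun_apply (B x t) v)"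
        by (rule blinfun_apply_integral[OF intB[OF x]])
      also have "\<dots> = integral (cbox 0 1) (\<lambda>t. ?F (x, t) (v, 0))"
        by (rule integral_cong) (rule B[OF x])
      finally show "blinfun_apply (integral (cbox 0 1) (B x)) v
          = integral {0..1} (\<lambda>t. ?F (x, t) (v, 0))" by simp
    qed
    ultimately show "((\<lambda>x. integral {0..1} (\<lambda>t. F (x, t))) has_derivative
        (\<lambda>v. integral {0..1} (\<lambda>t. ?F (x, t) (v, 0)))) (at x)"
      by (simp add: at_within_open[OF x S(1)])
  \<comment> \<open>Each directional derivative is again a parameter integral, with an integrand
    that is one order less smooth.\<close>
  qed (rule Suc.IH[OF ck])
qed

text \<open>Integrate the derivative of \<open>t \<mapsto> F (a + t (x - a))\<close> over
  \<open>[0, 1]\<close> and expand the direction \<open>x - a\<close> in the basis. Thus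
  \<open>H b x\<close> is the mean of the partial derivative in direction \<open>b\<close> along the
  segment from \<open>a\<close> to \<open>x\<close>.\<close>

lemma hadamard:
  fixes F :: "'e::euclidean_space \<Rightarrow> real"
  assumes r: "0 < r" and F: "Cinf_on (ball a r) F"
  obtains H where "\<And>b. Cinf_on (ball a (r/2)) (H b)"
    and "\<And>b. H b a = frechet_derivative F (at a) b"
    and "\<And>x. x \<in> ball a (r/2) \<Longrightarrow> F x = F a + (\<Sum>b\<in>Basis. ((x - a) \<bullet> b) * H b x)"
proof
  let ?F = "\<lambda>x. frechet_derivative F (at x)"
  let ?h = "\<lambda>(x, t). a + t *\<^sub>R (x - a)"
  define H where "H b x = integral {0..1} (\<lambda>t. ?F (?h (x, t)) b)" for b x
  \<comment> \<open>\<open>?T\<close> is an open interval around \<open>[0, 1]\<close>, so that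
    \<open>?S \<times> ?T\<close> is open and the end points are interior. Its points have absolute
    value below 2, so halving the radius keeps \<open>a + t (x - a)\<close> in
    \<open>ball a r\<close>.\<close>
  let ?S = "ball a (r/2)" and ?T = "{-1<..<2::real}"
  have h_in: "?h z \<in> ball a r" if "z \<in> ?S \<times> ?T" for z
  proof -
    obtain x t where z: "z = (x, t)" by (cases z)
    have "\<bar>t\<bar> * norm (x - a) \<le> 2 * norm (x - a)"
      using that z by (intro mult_right_mono) auto
    also have "\<dots> < r" using that z by (simp add: dist_norm norm_minus_commute)
    finally show ?thesis by (simp add: z dist_norm)
  qed
  have op: "open (?S \<times> ?T)" by (intro open_Times) auto
  have "Cinf_on (?S \<times> ?T) (\<lambda>z. a + snd z *\<^sub>R (fst z + - a))"
    by (intro Cinf_on_add Cinf_on_scaleR op Cinf_on_const Cinf_on_bounded_linear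
        bounded_linear_fst bounded_linear_snd)
  then have h: "Cinf_on (?S \<times> ?T) ?h" by (simp add: case_prod_unfold)
  show "Cinf_on ?S (H b)" for b
  proof -
    have "Cinf_on (?S \<times> ?T) (\<lambda>z. ?F (?h z) b)"
      by (rule Cinf_on_compose[OF op open_ball h_in h Cinf_on_frechet_derivative[OF F]])
    then show ?thesis unfolding Cinf_on_def H_def
      using Ck_on_integral[of ?S ?T _ "\<lambda>z. ?F (?h z) b"]
      by (simp add: subset_iff)
  qed
  show "H b a = ?F a b" for b by (simp add: H_def)
  show "F x = F a + (\<Sum>b\<in>Basis. ((x - a) \<bullet> b) * H b x)" if x: "x \<in> ?S" for x
  proof -
    have hin: "?h (x, t) \<in> ball a r" if "t \<in> {0..1}" for t
      by (rule h_in) (use that x in auto)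
    have dF: "(F has_derivative ?F (?h (x, t))) (at (?h (x, t)))" if "t \<in> {0..1}" for t
      by (rule Cinf_on_has_derivative[OF F hin[OF that]])
    have "((\<lambda>t. F (?h (x, t))) has_vector_derivative ?F (?h (x, t)) (x - a)) (at t within {0..1})"
      if "t \<in> {0..1}" for t
    proof -
      have "((\<lambda>t. ?h (x, t)) has_derivative (\<lambda>s. s *\<^sub>R (x - a))) (at t within {0..1})"
        by (auto intro!: derivative_eq_intros)
      from has_derivative_compose[OF this dF[OF that]] show ?thesis
        using linear_scale[OF has_derivative_linear[OF dF[OF that]]]
        by (simp add: has_vector_derivative_def)
    qed
    from fundamental_theorem_of_calculus[OF _ this]
    have I: "((\<lambda>t. ?F (?h (x, t)) (x - a)) has_integral F x - F a) {0..1}" by simp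
    have e: "?F (?h (x, t)) (x - a) = (\<Sum>b\<in>Basis. ((x - a) \<bullet> b) * ?F (?h (x, t)) b)"
      if "t \<in> {0..1}" for t
    proof -
      have l: "linear (?F (a + t *\<^sub>R (x - a)))"
        using has_derivative_linear[OF dF[OF that]] by simp
      have "?F (a + t *\<^sub>R (x - a)) (\<Sum>b\<in>Basis. ((x - a) \<bullet> b) *\<^sub>R b)
          = (\<Sum>b\<in>Basis. ((x - a) \<bullet> b) * ?F (a + t *\<^sub>R (x - a)) b)"
        by (simp only: linear_sum[OF l] linear_scale[OF l] real_scaleR_def)
      then show ?thesis by (simp only: euclidean_representation prod.case)
    qed
    have int: "(\<lambda>t. ?F (?h (x, t)) b) integrable_on {0..1}" for b
    proof -
      have "continuous_on (ball a r) (\<lambda>y. ?F y b)"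
        using Cinf_on_frechet_derivative[OF F] unfolding Cinf_on_def by (metis Ck_on.simps(1))
      then have "continuous_on {0..1} (\<lambda>t. ?F (?h (x, t)) b)"
        by (rule continuous_on_compose2) (use hin in \<open>auto intro!: continuous_intros\<close>)
      then show ?thesis by (rule integrable_continuous_real)
    qed
    have "F x - F a = integral {0..1} (\<lambda>t. ?F (?h (x, t)) (x - a))"
      using I by (simp add: integral_unique)
    also have "\<dots> = integral {0..1} (\<lambda>t. \<Sum>b\<in>Basis. ((x - a) \<bullet> b) * ?F (?h (x, t)) b)"
      by (rule integral_cong) (rule e)
    also have "\<dots> = (\<Sum>b\<in>Basis. integral {0..1} (\<lambda>t. ((x - a) \<bullet> b) * ?F (?h (x, t)) b))"
      by (rule integral_sum) (auto intro: integrable_on_mult_right[OF int, simplified])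
    finally show ?thesis by (simp add: H_def)
  qed
qed

section \<open>Traces of skew-adjoint and of anticommuting endomorphisms\<close>

text \<open>Linearity is assumed on \<open>V\<close> only, because the endomorphisms of the Lie
  algebra considered later have no prescribed behaviour outside it.\<close>

lemma linear_on_sum:
  fixes F :: "'v::real_vector \<Rightarrow> 'w::real_vector"
  assumes V: "subspace V" and "\<And>x y. x \<in> V \<Longrightarrow> y \<in> V \<Longrightarrow> F (x + y) = F x + F y"
    and "\<And>c x. x \<in> V \<Longrightarrow> F (c *\<^sub>R x) = c *\<^sub>R F x"
    and "finite I" "\<And>i. i \<in> I \<Longrightarrow> x i \<in> V"
  shows "F (\<Sum>i\<in>I. c i *\<^sub>R x i) = (\<Sum>i\<in>I. c i *\<^sub>R F (x i))"
  using assms(4,5)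
proof (induction I)
  case empty
  show ?case using assms(3)[of 0 0] subspace_0[OF V] by simp
next
  case (insert i I)
  then show ?case
    using assms(2,3) by (simp add: subspace_scale[OF V] subspace_sum[OF V])
qed

text \<open>The chosen basis depends on \<open>V\<close> alone, so one \<open>B\<close> computes all
  traces at once. If it is infinite, the defining sum is 0 and the identities below are trivial;
  otherwise coordinates are available.\<close>

lemma trace_on_cases:
  assumes "subspace V"
  obtains "\<And>F. trace_on V F = 0"
  | B where "finite B" "independent B" "span B = V"
    "\<And>F. trace_on V F = (\<Sum>b\<in>B. representation B (F b) b)"
proof -
  define B where "B = (SOME B. B \<subseteq> V \<and> independent B \<and> V \<subseteq> span B)"
  have "\<exists>B. B \<subseteq> V \<and> independent B \<and> V \<subseteq> span B" by (metis basis_exists)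
  then have B: "B \<subseteq> V" "independent B" "V \<subseteq> span B"
    unfolding B_def by (metis (mono_tags, lifting) someI_ex)+
  have t: "trace_on V F = (\<Sum>b\<in>B. representation B (F b) b)" for F
    by (simp add: trace_on_def B_def Let_def)
  show ?thesis
  proof (cases "finite B")
    case True
    show ?thesis using that(2)[OF True B(2) _ t] B span_subspace[OF B(1,3) assms] by blast
  qed (use that(1) t in simp)
qed

lemma representation_sum_eq:
  assumes "finite B" "independent B" "x \<in> span B"
  shows "(\<Sum>b\<in>B. representation B x b *\<^sub>R b) = x"
  using sum_representation_eq[OF assms(2,3) assms(1)] by simp

lemma trace_on_commute:
  assumes V: "subspace V"
    and S: "\<And>x. x \<in> V \<Longrightarrow> S x \<in> V" "\<And>x y. x \<in> V \<Longrightarrow> y \<in> V \<Longrightarrow> S (x + y) = S x + S y"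
      "\<And>c x. x \<in> V \<Longrightarrow> S (c *\<^sub>R x) = c *\<^sub>R S x"
    and T: "\<And>x. x \<in> V \<Longrightarrow> T x \<in> V" "\<And>x y. x \<in> V \<Longrightarrow> y \<in> V \<Longrightarrow> T (x + y) = T x + T y"
      "\<And>c x. x \<in> V \<Longrightarrow> T (c *\<^sub>R x) = c *\<^sub>R T x"
  shows "trace_on V (\<lambda>x. S (T x)) = trace_on V (\<lambda>x. T (S x))"
proof (rule trace_on_cases[OF V])
  fix B assume B: "finite B" "independent B" "span B = V"
    and t: "\<And>F. trace_on V F = (\<Sum>b\<in>B. representation B (F b) b)"
  let ?r = "representation B"
  have inV: "b \<in> V" if "b \<in> B" for b using that B(3) span_base by blast
  \<comment> \<open>Matrix multiplication in the basis \<open>B\<close>, for a diagonal entry of the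
    composite.\<close>
  have exp: "?r (P (Q b)) b = (\<Sum>c\<in>B. ?r (Q b) c * ?r (P c) b)"
    if P: "\<And>x. x \<in> V \<Longrightarrow> P x \<in> V" "\<And>x y. x \<in> V \<Longrightarrow> y \<in> V \<Longrightarrow> P (x + y) = P x + P y"
      "\<And>c x. x \<in> V \<Longrightarrow> P (c *\<^sub>R x) = c *\<^sub>R P x" and Q: "Q b \<in> V" for P Q b
  proof -
    have "P (Q b) = P (\<Sum>c\<in>B. ?r (Q b) c *\<^sub>R c)"
      using representation_sum_eq[OF B(1,2)] Q B(3) by simp
    also have "\<dots> = (\<Sum>c\<in>B. ?r (Q b) c *\<^sub>R P c)"
      by (rule linear_on_sum[OF V P(2,3) B(1) inV])
    finally show ?thesis
      using B P(1) inV by (simp add: representation_sum representation_scale span_scale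
          subspace_scale[OF V])
  qed
  have "trace_on V (\<lambda>x. S (T x)) = (\<Sum>b\<in>B. \<Sum>c\<in>B. ?r (T b) c * ?r (S c) b)"
    unfolding t by (rule sum.cong[OF refl], rule exp[OF S]) (use T inV in auto)
  also have "\<dots> = (\<Sum>c\<in>B. \<Sum>b\<in>B. ?r (S c) b * ?r (T b) c)"
    by (subst sum.swap) (simp add: mult.commute)
  also have "\<dots> = trace_on V (\<lambda>x. T (S x))"
    unfolding t by (rule sum.cong[OF refl], rule exp[OF T, symmetric]) (use S inV in auto)
  finally show ?thesis .
qed simp

lemma trace_on_cong:
  assumes "subspace V" "\<And>x. x \<in> V \<Longrightarrow> F x = F' x"
  shows "trace_on V F = trace_on V F'"
  using assms(1)
proof (cases rule: trace_on_cases)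
  case (2 B)
  then show ?thesis using assms(2) span_base by (metis (no_types, lifting) sum.cong)
qed simp

lemma trace_on_diff:
  assumes "subspace V" "\<And>x. x \<in> V \<Longrightarrow> F x \<in> V" "\<And>x. x \<in> V \<Longrightarrow> F' x \<in> V"
  shows "trace_on V (\<lambda>x. F x - F' x) = trace_on V F - trace_on V F'"
  using assms(1)
proof (cases rule: trace_on_cases)
  case (2 B)
  have "representation B (F b - F' b) b = representation B (F b) b - representation B (F' b) b"
    if "b \<in> B" for b
    using that 2(2,3) assms(2,3) span_base[OF that] by (simp add: representation_diff)
  then show ?thesis by (simp add: 2(4) sum_subtractf)
qed simp

lemma trace_on_minus:
  assumes "subspace V" "\<And>x. x \<in> V \<Longrightarrow> F x \<in> V"
  shows "trace_on V (\<lambda>x. - F x) = - trace_on V F"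
  using assms(1)
proof (cases rule: trace_on_cases)
  case (2 B)
  have "representation B (- F b) b = - representation B (F b) b" if "b \<in> B" for b
    using that 2(2,3) assms(2) span_base[OF that] by (simp add: representation_neg)
  then show ?thesis by (simp add: 2(4) sum_negf)
qed simp

section \<open>Dual bases, and traces that equal their own negative\<close>

lemma dual_basis_exists:
  fixes g :: "'v::real_vector \<Rightarrow> 'v \<Rightarrow> real"
  assumes B: "finite B" "independent B"
    and add: "\<And>x y z. x \<in> span B \<Longrightarrow> y \<in> span B \<Longrightarrow> z \<in> span B \<Longrightarrow> g (x + y) z = g x z + g y z"
    and scale: "\<And>c x z. x \<in> span B \<Longrightarrow> z \<in> span B \<Longrightarrow> g (c *\<^sub>R x) z = c * g x z"
    and add2: "\<And>x y z. x \<in> span B \<Longrightarrow> y \<in> span B \<Longrightarrow> z \<in> span B \<Longrightarrow> g z (x + y) = g z x + g z y"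
    and scale2: "\<And>c x z. x \<in> span B \<Longrightarrow> z \<in> span B \<Longrightarrow> g z (c *\<^sub>R x) = c * g z x"
    and nondeg: "\<And>x. x \<in> span B \<Longrightarrow> (\<And>y. y \<in> span B \<Longrightarrow> g x y = 0) \<Longrightarrow> x = 0"
  shows "\<exists>d. \<forall>b\<in>B. d b \<in> span B \<and> (\<forall>c\<in>B. g (d b) c = (if b = c then 1 else 0))"
proof -
  \<comment> \<open>The map from vectors to functionals, with functionals recorded by their values
    on \<open>B\<close> and cut off elsewhere; its values then lie in the span of the delta
    functions \<open>e b\<close>. Nondegeneracy makes it injective on \<open>span B\<close>, so by
    counting it reaches every \<open>e b\<close>, and \<open>d b\<close> is a preimage.\<close>
  define \<Phi> :: "'v \<Rightarrow> 'v \<Rightarrow> real" where "\<Phi> x = (\<lambda>c. if c \<in> B then g x c else 0)" for x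
  define e :: "'v \<Rightarrow> 'v \<Rightarrow> real" where "e b = (\<lambda>c. if b = c then 1 else 0)" for b
  have inB: "b \<in> span B" if "b \<in> B" for b using that by (rule span_base)
  have \<Phi>_add: "\<Phi> (x + y) = \<Phi> x + \<Phi> y" if "x \<in> span B" "y \<in> span B" for x y
    using that add inB by (auto simp: \<Phi>_def fun_eq_iff)
  have \<Phi>_scale: "\<Phi> (c *\<^sub>R x) = c *\<^sub>R \<Phi> x" if "x \<in> span B" for c x
    using that scale inB by (auto simp: \<Phi>_def fun_eq_iff scaleR_fun_def)
  have \<Phi>_0: "x = 0" if x: "x \<in> span B" "\<Phi> x = 0" for x
  proof (rule nondeg[OF x(1)])
    fix y assume y: "y \<in> span B"
    have "g x (\<Sum>b\<in>B. representation B y b *\<^sub>R b) = (\<Sum>b\<in>B. representation B y b *\<^sub>R g x b)"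
      by (rule linear_on_sum[OF subspace_span]) (use x add2 scale2 inB B(1) in auto)
    moreover have "g x b = 0" if "b \<in> B" for b
      using x(2) that by (auto simp: \<Phi>_def fun_eq_iff dest: spec[of _ b])
    ultimately show "g x y = 0"
      using representation_sum_eq[OF B y] by simp
  qed
  have \<Phi>_sum: "\<Phi> (\<Sum>b\<in>B. u b *\<^sub>R b) = (\<Sum>b\<in>B. u b *\<^sub>R \<Phi> b)" for u
    by (rule linear_on_sum[OF subspace_span \<Phi>_add \<Phi>_scale B(1) inB])
  have sp: "(\<Sum>b\<in>B. u b *\<^sub>R b) \<in> span B" for u
    by (intro span_sum span_scale inB)
  have zero: "\<forall>b\<in>B. u b = 0" if "(\<Sum>b\<in>B. u b *\<^sub>R \<Phi> b) = 0" for u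
  proof -
    have "(\<Sum>b\<in>B. u b *\<^sub>R b) = 0" using \<Phi>_0[OF sp] that \<Phi>_sum by simp
    then show ?thesis using B by (auto simp: independent_explicit_finite_subsets)
  qed
  have inj: "inj_on \<Phi> B"
  proof
    fix b c assume bc: "b \<in> B" "c \<in> B" "\<Phi> b = \<Phi> c"
    have "\<Phi> (b + (-1) *\<^sub>R c) = \<Phi> b + (-1) *\<^sub>R \<Phi> c"
      using bc inB by (simp only: \<Phi>_add \<Phi>_scale span_scale)
    then have "b + (-1) *\<^sub>R c = 0"
      using bc inB by (intro \<Phi>_0) (auto intro: span_add span_neg span_diff)
    then show "b = c" by simp
  qed
  have ind: "independent (\<Phi> ` B)"
  proof (rule independent_if_scalars_zero)
    fix f x assume s: "(\<Sum>x\<in>\<Phi> ` B. f x *\<^sub>R x) = 0" and x: "x \<in> \<Phi> ` B"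
    have "(\<Sum>b\<in>B. f (\<Phi> b) *\<^sub>R \<Phi> b) = 0" using s by (simp add: sum.reindex[OF inj])
    from zero[OF this] show "f x = 0" using x by auto
  qed (use B in simp)
  have exp: "h = (\<Sum>b\<in>B. h b *\<^sub>R e b)" if "\<And>c. c \<notin> B \<Longrightarrow> h c = 0" for h :: "'v \<Rightarrow> real"
  proof
    fix c
    have "(\<Sum>b\<in>B. h b *\<^sub>R e b) c = (\<Sum>b\<in>B. h b * e b c)"
      using B(1) by (induction B) (auto simp: scaleR_fun_def)
    also have "\<dots> = h c" using B(1) that by (simp add: e_def if_distrib sum.delta cong: if_cong)
    finally show "h c = (\<Sum>b\<in>B. h b *\<^sub>R e b) c" by simp
  qed
  have sub: "\<Phi> ` B \<subseteq> span (e ` B)"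
  proof
    fix h assume "h \<in> \<Phi> ` B"
    then have "h = (\<Sum>b\<in>B. h b *\<^sub>R e b)" by (intro exp) (auto simp: \<Phi>_def)
    also have "\<dots> \<in> span (e ` B)" by (intro span_sum span_scale span_base) auto
    finally show "h \<in> span (e ` B)" .
  qed
  have inje: "inj_on e B"
    by (rule inj_onI) (metis e_def zero_neq_one)
  \<comment> \<open>Otherwise \<open>e b\<close> together with the image of \<open>B\<close> would
    be an independent family with one member more than the delta functions whose span contains
    it.\<close>
  have esp: "e b \<in> span (\<Phi> ` B)" if b: "b \<in> B" for b
  proof (rule ccontr)
    assume n: "e b \<notin> span (\<Phi> ` B)"
    then have "independent (insert (e b) (\<Phi> ` B))" using ind by (rule independent_insertI)
    moreover have "insert (e b) (\<Phi> ` B) \<subseteq> span (e ` B)"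
      using sub b by (simp add: span_base)
    ultimately have "card (insert (e b) (\<Phi> ` B)) \<le> card (e ` B)"
      using independent_span_bound B(1) by blast
    moreover have "e b \<notin> \<Phi> ` B" using n by (auto intro: span_base)
    ultimately show False using B(1) by (simp add: card_image inj inje)
  qed
  have "\<exists>x\<in>span B. \<Phi> x = e b" if b: "b \<in> B" for b
  proof -
    have "e b \<in> range (\<lambda>u. \<Sum>v\<in>\<Phi> ` B. u v *\<^sub>R v)"
      using esp[OF b] B(1) by (simp add: span_finite)
    then obtain u where "e b = (\<Sum>v\<in>\<Phi> ` B. u v *\<^sub>R v)" by auto
    then have "e b = \<Phi> (\<Sum>c\<in>B. u (\<Phi> c) *\<^sub>R c)"
      by (simp add: sum.reindex[OF inj] \<Phi>_sum)
    then show ?thesis using sp by metis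
  qed
  then obtain d where d: "\<And>b. b \<in> B \<Longrightarrow> d b \<in> span B \<and> \<Phi> (d b) = e b" by metis
  have "g (d b) c = (if b = c then 1 else 0)" if "b \<in> B" "c \<in> B" for b c
  proof -
    have "\<Phi> (d b) c = e b c" using d[OF that(1)] by simp
    then show ?thesis using that by (simp add: \<Phi>_def e_def)
  qed
  then show ?thesis using d by blast
qed

text \<open>A dual basis \<open>d\<close> takes the place of an orthonormal one, as \<open>g\<close>
  may be indefinite. The trace is the sum of \<open>g (d b) (T b)\<close>. The sum of
  \<open>g (T (d b)) b\<close> is the same number, because the Gram matrix
  \<open>g (d c) (d b)\<close> expressing the dual basis through \<open>B\<close> is symmetric;
  skewness makes it the negative of that number.\<close>

lemma trace_on_skew_eq_0:
  fixes g :: "'v::real_vector \<Rightarrow> 'v \<Rightarrow> real"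
  assumes V: "subspace V"
    and sym: "\<And>x y. x \<in> V \<Longrightarrow> y \<in> V \<Longrightarrow> g x y = g y x"
    and add: "\<And>x y z. x \<in> V \<Longrightarrow> y \<in> V \<Longrightarrow> z \<in> V \<Longrightarrow> g (x + y) z = g x z + g y z"
    and scale: "\<And>c x z. x \<in> V \<Longrightarrow> z \<in> V \<Longrightarrow> g (c *\<^sub>R x) z = c * g x z"
    and nondeg: "\<And>x. x \<in> V \<Longrightarrow> (\<And>y. y \<in> V \<Longrightarrow> g x y = 0) \<Longrightarrow> x = 0"
    and T: "\<And>x. x \<in> V \<Longrightarrow> T x \<in> V" "\<And>x y. x \<in> V \<Longrightarrow> y \<in> V \<Longrightarrow> T (x + y) = T x + T y"
      "\<And>c x. x \<in> V \<Longrightarrow> T (c *\<^sub>R x) = c *\<^sub>R T x"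
    and skew: "\<And>x y. x \<in> V \<Longrightarrow> y \<in> V \<Longrightarrow> g (T x) y = - g x (T y)"
  shows "trace_on V T = 0"
proof (rule trace_on_cases[OF V])
  fix B assume B: "finite B" "independent B" "span B = V"
    and t: "\<And>F. trace_on V F = (\<Sum>b\<in>B. representation B (F b) b)"
  have add2: "g z (x + y) = g z x + g z y" if "x \<in> V" "y \<in> V" "z \<in> V" for x y z
    using that add[of x y z] sym subspace_add[OF V] by metis
  have scale2: "g z (c *\<^sub>R x) = c * g z x" if "x \<in> V" "z \<in> V" for c x z
    using that scale[of x z c] sym subspace_scale[OF V] by metis
  have ex: "\<exists>d. \<forall>b\<in>B. d b \<in> V \<and> (\<forall>c\<in>B. g (d b) c = (if b = c then 1 else 0))"
    by (rule dual_basis_exists[OF B(1,2), of g, unfolded B(3)],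
        fact add, fact scale, fact add2, fact scale2, fact nondeg)
  obtain d where dV: "\<And>b. b \<in> B \<Longrightarrow> d b \<in> V"
    and d: "\<And>b c. b \<in> B \<Longrightarrow> c \<in> B \<Longrightarrow> g (d b) c = (if b = c then 1 else 0)"
    using ex by metis
  have inV: "b \<in> V" if "b \<in> B" for b using that B(3) span_base by blast
  have r: "representation B x b = g (d b) x" if "x \<in> V" "b \<in> B" for x b
  proof -
    have "g (d b) x = g (d b) (\<Sum>c\<in>B. representation B x c *\<^sub>R c)"
      using representation_sum_eq[OF B(1,2)] that B(3) by simp
    also have "\<dots> = (\<Sum>c\<in>B. representation B x c *\<^sub>R g (d b) c)"
      by (rule linear_on_sum[OF V]) (use add2 scale2 that dV inV B(1) in auto)
    also have "\<dots> = (\<Sum>c\<in>B. if b = c then representation B x c else 0)"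
      by (rule sum.cong) (use d that in auto)
    also have "\<dots> = representation B x b" using that B(1) by (simp add: sum.delta)
    finally show ?thesis by simp
  qed
  have exp: "x = (\<Sum>c\<in>B. g (d c) x *\<^sub>R c)" if "x \<in> V" for x
    using representation_sum_eq[OF B(1,2), of x] that B(3) r by simp
  have tr: "trace_on V T = (\<Sum>b\<in>B. g (d b) (T b))"
    unfolding t using r T(1) inV by simp
  have gTd: "g (T (d b)) b = (\<Sum>c\<in>B. g (d c) (d b) * g (T c) b)" if "b \<in> B" for b
  proof -
    have "T (d b) = (\<Sum>c\<in>B. g (d c) (d b) *\<^sub>R T c)"
      by (subst exp[OF dV[OF that]]) (rule linear_on_sum[OF V T(2,3) B(1) inV])
    also have "g \<dots> b = (\<Sum>c\<in>B. g (d c) (d b) *\<^sub>R g (T c) b)"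
      by (rule linear_on_sum[OF V, of "\<lambda>x. g x b"]) (use add scale that inV B(1) T(1) in auto)
    finally show ?thesis by simp
  qed
  have gTc: "g (T c) (d c) = (\<Sum>b\<in>B. g (d b) (d c) * g (T c) b)" if "c \<in> B" for c
  proof -
    have "g (T c) (d c) = g (T c) (\<Sum>b\<in>B. g (d b) (d c) *\<^sub>R b)"
      using exp[OF dV[OF that]] by simp
    also have "\<dots> = (\<Sum>b\<in>B. g (d b) (d c) *\<^sub>R g (T c) b)"
      by (rule linear_on_sum[OF V]) (use add2 scale2 that inV B(1) T(1) in auto)
    finally show ?thesis by simp
  qed
  have "(\<Sum>b\<in>B. g (T (d b)) b) = (\<Sum>b\<in>B. \<Sum>c\<in>B. g (d c) (d b) * g (T c) b)"
    using gTd by simp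
  also have "\<dots> = (\<Sum>c\<in>B. \<Sum>b\<in>B. g (d b) (d c) * g (T c) b)"
    by (subst sum.swap) (auto intro!: sum.cong simp: sym[OF dV dV])
  also have "\<dots> = (\<Sum>c\<in>B. g (d c) (T c))"
    using gTc sym dV T(1) inV by simp
  finally have "(\<Sum>b\<in>B. g (T (d b)) b) = trace_on V T" using tr by simp
  moreover have "(\<Sum>b\<in>B. g (T (d b)) b) = - (\<Sum>b\<in>B. g (d b) (T b))"
    using skew dV inV by (simp add: sum_negf)
  ultimately show ?thesis using tr by simp
qed simp

text \<open>Anticommutation gives \<open>J T J = - J J T = T\<close>, and cyclicity turns the trace
  of \<open>J T J\<close> into that of \<open>T J J = - T\<close>.\<close>

lemma trace_on_anticommute_eq_0:
  assumes V: "subspace V"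
    and J: "\<And>x. x \<in> V \<Longrightarrow> J x \<in> V" "\<And>x y. x \<in> V \<Longrightarrow> y \<in> V \<Longrightarrow> J (x + y) = J x + J y"
      "\<And>c x. x \<in> V \<Longrightarrow> J (c *\<^sub>R x) = c *\<^sub>R J x" "\<And>x. x \<in> V \<Longrightarrow> J (J x) = - x"
    and T: "\<And>x. x \<in> V \<Longrightarrow> T x \<in> V" "\<And>x y. x \<in> V \<Longrightarrow> y \<in> V \<Longrightarrow> T (x + y) = T x + T y"
      "\<And>c x. x \<in> V \<Longrightarrow> T (c *\<^sub>R x) = c *\<^sub>R T x"
    and JT: "\<And>x. x \<in> V \<Longrightarrow> T (J x) = - J (T x)"
  shows "trace_on V T = 0"
proof -
  have neg: "F (- x) = - F x" if "x \<in> V" "\<And>c x. x \<in> V \<Longrightarrow> F (c *\<^sub>R x) = c *\<^sub>R F x"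
    for F :: "'a \<Rightarrow> 'a" and x
    using that(2)[OF that(1), of "-1"] by simp
  have "trace_on V T = trace_on V (\<lambda>x. J (T (J x)))"
    using JT J T neg[of _ J] by (intro trace_on_cong[OF V]) (simp add: subspace_neg[OF V])
  also have "\<dots> = trace_on V (\<lambda>x. T (J (J x)))"
    by (rule trace_on_commute[OF V J(1-3)]) (use J T in auto)
  also have "\<dots> = trace_on V (\<lambda>x. - T x)"
    using J T neg[of _ T] by (intro trace_on_cong[OF V]) simp
  also have "\<dots> = - trace_on V T" by (rule trace_on_minus[OF V T(1)])
  finally show ?thesis by simp
qed

section \<open>Linear algebra of an abelian anti-Kaehler structure\<close>

lemma sym_skew_trilinear_eq_0:
  fixes a :: "'v \<Rightarrow> 'v \<Rightarrow> 'v \<Rightarrow> real"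
  assumes "\<And>x y z. x \<in> V \<Longrightarrow> y \<in> V \<Longrightarrow> z \<in> V \<Longrightarrow> a x y z = a y x z"
    and "\<And>x y z. x \<in> V \<Longrightarrow> y \<in> V \<Longrightarrow> z \<in> V \<Longrightarrow> a x y z = - a x z y"
    and "x \<in> V" "y \<in> V" "z \<in> V"
  shows "a x y z = 0"
  \<comment> \<open>Alternating the two transpositions runs through all six orders of the arguments
    and comes back after three sign changes. The same computation underlies the uniqueness of the
    Levi-Civita connection.\<close>
  using assms(1)[of x y z] assms(2)[of y x z] assms(1)[of y z x] assms(2)[of z y x]
    assms(1)[of z x y] assms(2)[of x z y] assms(3-5) by simp

text \<open>What the geometry leaves behind on left invariant fields. The law \<open>metric\<close>
  has no derivative of \<open>g y z\<close>, since that function is constant on the group, and every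
  law is relative to \<open>V\<close>.\<close>

locale anti_kaehler_abelian =
  fixes V :: "'v::real_vector set" and g :: "'v \<Rightarrow> 'v \<Rightarrow> real" and J :: "'v \<Rightarrow> 'v"
    and N :: "'v \<Rightarrow> 'v \<Rightarrow> 'v" and br :: "'v \<Rightarrow> 'v \<Rightarrow> 'v"
  assumes V: "subspace V"
    and sym: "\<And>x y. x \<in> V \<Longrightarrow> y \<in> V \<Longrightarrow> g x y = g y x"
    and add: "\<And>x y z. x \<in> V \<Longrightarrow> y \<in> V \<Longrightarrow> z \<in> V \<Longrightarrow> g (x + y) z = g x z + g y z"
    and scale: "\<And>c x z. x \<in> V \<Longrightarrow> z \<in> V \<Longrightarrow> g (c *\<^sub>R x) z = c * g x z"
    and nondeg: "\<And>x. x \<in> V \<Longrightarrow> (\<And>y. y \<in> V \<Longrightarrow> g x y = 0) \<Longrightarrow> x = 0"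
    and J: "\<And>x. x \<in> V \<Longrightarrow> J x \<in> V" "\<And>x y. x \<in> V \<Longrightarrow> y \<in> V \<Longrightarrow> J (x + y) = J x + J y"
      "\<And>c x. x \<in> V \<Longrightarrow> J (c *\<^sub>R x) = c *\<^sub>R J x" "\<And>x. x \<in> V \<Longrightarrow> J (J x) = - x"
    and gJ: "\<And>x y. x \<in> V \<Longrightarrow> y \<in> V \<Longrightarrow> g (J x) (J y) = - g x y"
    and N: "\<And>x y. x \<in> V \<Longrightarrow> y \<in> V \<Longrightarrow> N x y \<in> V"
      "\<And>x y z. x \<in> V \<Longrightarrow> y \<in> V \<Longrightarrow> z \<in> V \<Longrightarrow> N (x + y) z = N x z + N y z"
      "\<And>x y z. x \<in> V \<Longrightarrow> y \<in> V \<Longrightarrow> z \<in> V \<Longrightarrow> N x (y + z) = N x y + N x z"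
      "\<And>c x y. x \<in> V \<Longrightarrow> y \<in> V \<Longrightarrow> N (c *\<^sub>R x) y = c *\<^sub>R N x y"
      "\<And>c x y. x \<in> V \<Longrightarrow> y \<in> V \<Longrightarrow> N x (c *\<^sub>R y) = c *\<^sub>R N x y"
    and torsion_free: "\<And>x y. x \<in> V \<Longrightarrow> y \<in> V \<Longrightarrow> br x y = N x y - N y x"
    and metric: "\<And>x y z. x \<in> V \<Longrightarrow> y \<in> V \<Longrightarrow> z \<in> V \<Longrightarrow> g (N x y) z + g y (N x z) = 0"
    and parallel: "\<And>x y. x \<in> V \<Longrightarrow> y \<in> V \<Longrightarrow> N x (J y) = J (N x y)"
    and abelian: "\<And>x y. x \<in> V \<Longrightarrow> y \<in> V \<Longrightarrow> br (J x) (J y) = br x y"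
begin

lemma g_neg: "x \<in> V \<Longrightarrow> z \<in> V \<Longrightarrow> g (- x) z = - g x z"
  using scale[of x z "-1"] by simp

lemma g_diff: "x \<in> V \<Longrightarrow> y \<in> V \<Longrightarrow> z \<in> V \<Longrightarrow> g (x - y) z = g x z - g y z"
  using add[of x "- y" z] g_neg by (simp add: subspace_neg[OF V])

text \<open>Put \<open>J y\<close> for \<open>y\<close> in \<open>gJ\<close>; the two minus signs
  cancel.\<close>

lemma g_J_left: "x \<in> V \<Longrightarrow> y \<in> V \<Longrightarrow> g (J x) y = g x (J y)"
  using gJ[of "x" "J y"] J(1,4)[of y] g_neg[of y "J x"] sym J(1) subspace_neg[OF V]
  by (metis minus_minus)

lemma N_J_left:
  assumes x: "x \<in> V" and y: "y \<in> V"
  shows "N (J x) y = - J (N x y)"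
proof -
  define A where "A x y = N x y - J (N (J x) y)" for x y
  have AV: "A x y \<in> V" if "x \<in> V" "y \<in> V" for x y
    using that by (simp add: A_def N J subspace_diff[OF V])
  \<comment> \<open>Parallelism turns \<open>J (N (J x) y)\<close> into
    \<open>N (J x) (J y)\<close>, so \<open>A x y - A y x\<close> is
    \<open>br x y - br (J x) (J y)\<close>.\<close>
  have Asym: "A x y = A y x" if "x \<in> V" "y \<in> V" for x y
    using abelian[OF that] that J(1)
    by (simp add: torsion_free parallel A_def algebra_simps)
  have Askew: "g (A x y) z = - g (A x z) y" if "x \<in> V" "y \<in> V" "z \<in> V" for x y z
  proof -
    have m: "g (N w u) v = - g (N w v) u" if "w \<in> V" "u \<in> V" "v \<in> V" for w u v
      using metric[OF that] that sym N(1) by fastforce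
    \<comment> \<open>Move \<open>J\<close> across by self-adjointness, use \<open>metric\<close> in
      direction \<open>J x\<close>, and pull \<open>J\<close> out again by parallelism.\<close>
    have "g (J (N (J x) y)) z = - g (J (N (J x) z)) y"
      using that m[of "J x" y "J z"] by (simp add: g_J_left N J parallel)
    then show ?thesis
      using that m[of x y z] by (simp add: A_def g_diff N J)
  qed
  have "g (A x y) z = 0" if "z \<in> V" for z
  proof (rule sym_skew_trilinear_eq_0[of V "\<lambda>x y z. g (A x y) z", OF _ _ x y that])
    show "g (A x y) z = g (A y x) z" if "x \<in> V" "y \<in> V" "z \<in> V" for x y z
      using Asym[OF that(1,2)] by metis
  qed (rule Askew)
  then have "A x y = 0" using nondeg AV x y by blast
  then have "J (N x y) = J (J (N (J x) y))" by (simp add: A_def)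
  then show ?thesis using x y J N(1) by simp
qed

lemma trace_on_br_eq_0:
  assumes x: "x \<in> V"
  shows "trace_on V (br x) = 0"
proof -
  have "trace_on V (br x) = trace_on V (\<lambda>y. N x y - N y x)"
    by (rule trace_on_cong[OF V]) (use torsion_free x in auto)
  also have "\<dots> = trace_on V (N x) - trace_on V (\<lambda>y. N y x)"
    by (rule trace_on_diff[OF V]) (use x N in auto)
  also have "trace_on V (N x) = 0"
    by (rule trace_on_skew_eq_0[OF V sym add scale nondeg])
      (use x N metric in \<open>auto simp: eq_neg_iff_add_eq_0\<close>)
  also have "trace_on V (\<lambda>y. N y x) = 0"
    by (rule trace_on_anticommute_eq_0[OF V J]) (use x N N_J_left in auto)
  finally show ?thesis by simp
qed

end

section \<open>Left invariant vector fields\<close>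

lemma scaleR_fun_apply: "(c *\<^sub>R f) x = c *\<^sub>R f x"
  by (simp add: scaleR_fun_def)

locale lie_group_loc =
  fixes G :: "('a, 'e::euclidean_space) charted_group" (structure)
  assumes lie: "lie_group G"

sublocale lie_group_loc \<subseteq> group G
  using lie by (simp add: lie_group_def)

context lie_group_loc
begin

section \<open>Charts of the group\<close>

lemma topspace_eq: "topspace (top_of G) = carrier G"
  using lie by (simp add: lie_group_def smooth_manifold_def)

lemma openin_carrier: "openin (top_of G) (carrier G)"
  using openin_topspace[of "top_of G"] by (simp add: topspace_eq)

lemma openin_subset_carrier: "openin (top_of G) U \<Longrightarrow> U \<subseteq> carrier G"
  using openin_subset topspace_eq by metis

lemma chart_exists:
  assumes "p \<in> carrier G"
  obtains U \<phi> where "(U, \<phi>) \<in> atlas G" "p \<in> U"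
proof -
  have "(\<Union>(U, \<phi>)\<in>atlas G. U) = carrier G"
    using lie by (simp add: lie_group_def smooth_manifold_def)
  then show ?thesis using assms that by blast
qed

lemma chart_props:
  assumes "(U, \<phi>) \<in> atlas G"
  shows chart_openin: "openin (top_of G) U"
    and chart_open: "open (\<phi> ` U)"
    and chart_homeomorphic: "homeomorphic_map (subtopology (top_of G) U) (top_of_set (\<phi> ` U)) \<phi>"
proof -
  have "\<forall>(U, \<phi>)\<in>atlas G. openin (top_of G) U \<and> open (\<phi> ` U) \<and>
       homeomorphic_map (subtopology (top_of G) U) (top_of_set (\<phi> ` U)) \<phi>"
    using lie by (simp add: lie_group_def smooth_manifold_def)
  with assms show "openin (top_of G) U" "open (\<phi> ` U)"
    "homeomorphic_map (subtopology (top_of G) U) (top_of_set (\<phi> ` U)) \<phi>" by auto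
qed

lemma chart_subset: "(U, \<phi>) \<in> atlas G \<Longrightarrow> U \<subseteq> carrier G"
  using chart_openin openin_subset_carrier by blast

lemma chart_topspace: "(U, \<phi>) \<in> atlas G \<Longrightarrow> topspace (top_of G) \<inter> U = U"
  using chart_subset topspace_eq by auto

lemma chart_inv_into:
  assumes "(U, \<phi>) \<in> atlas G" "x \<in> U"
  shows "inv_into U \<phi> (\<phi> x) = x"
  using homeomorphic_imp_injective_map[OF chart_homeomorphic[OF assms(1)]] assms
  by (simp add: chart_topspace)

lemma chart_image_eq:
  assumes "(U, \<phi>) \<in> atlas G"
  shows "\<phi> ` (W \<inter> U) = {y \<in> \<phi> ` U. inv_into U \<phi> y \<in> W}"
  using chart_inv_into[OF assms] by auto

lemma chart_image_open:
  assumes "(U, \<phi>) \<in> atlas G" "openin (top_of G) W"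
  shows "open (\<phi> ` (W \<inter> U))"
proof -
  have "openin (subtopology (top_of G) U) (W \<inter> U)"
    using assms(2) by (auto simp: openin_subtopology)
  then have "openin (top_of_set (\<phi> ` U)) (\<phi> ` (W \<inter> U))"
    using homeomorphic_imp_open_map[OF chart_homeomorphic[OF assms(1)]] by (simp add: open_map_def)
  then show ?thesis using chart_open[OF assms(1)] by (simp add: openin_open_eq)
qed

lemma chart_preimage_open:
  assumes "(U, \<phi>) \<in> atlas G" "open S"
  shows "openin (top_of G) {x \<in> U. \<phi> x \<in> S}"
proof -
  have "openin (subtopology (top_of G) U) {x \<in> topspace (subtopology (top_of G) U). \<phi> x \<in> \<phi> ` U \<inter> S}"
    by (rule openin_continuous_map_preimage[OF
          homeomorphic_imp_continuous_map[OF chart_homeomorphic[OF assms(1)]]])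
      (use assms(2) in \<open>auto simp: openin_open\<close>)
  moreover have "{x \<in> U. \<phi> x \<in> \<phi> ` U \<inter> S} = {x \<in> U. \<phi> x \<in> S}" by auto
  ultimately show ?thesis
    using chart_openin[OF assms(1)] by (simp add: chart_topspace[OF assms(1)] openin_trans_full)
qed

lemma chart_continuous_inv:
  assumes "(U, \<phi>) \<in> atlas G"
  shows "continuous_map (top_of_set (\<phi> ` U)) (top_of G) (inv_into U \<phi>)"
proof -
  obtain h where h: "homeomorphic_maps (subtopology (top_of G) U) (top_of_set (\<phi> ` U)) \<phi> h"
    using chart_homeomorphic[OF assms] homeomorphic_map_maps by blast
  then have "continuous_map (top_of_set (\<phi> ` U)) (top_of G) h"
    by (auto simp: homeomorphic_maps_def intro: continuous_map_into_fulltopology)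
  then show ?thesis
  proof (rule continuous_map_eq)
    fix y assume "y \<in> topspace (top_of_set (\<phi> ` U))"
    then obtain x where "x \<in> U" "y = \<phi> x" by auto
    then show "h y = inv_into U \<phi> y"
      using h assms by (simp add: homeomorphic_maps_def chart_topspace chart_inv_into)
  qed
qed

section \<open>Smooth functions on open sets and near a point\<close>

lemma smooth_funD:
  "smooth_fun G Q f \<Longrightarrow> (V, \<psi>) \<in> atlas G \<Longrightarrow> Cinf_on (\<psi> ` (Q \<inter> V)) (\<lambda>y. f (inv_into V \<psi> y))"
  unfolding smooth_fun_def comp_def by blast

lemma smooth_funI:
  "(\<And>V \<psi>. (V, \<psi>) \<in> atlas G \<Longrightarrow> Cinf_on (\<psi> ` (Q \<inter> V)) (\<lambda>y. f (inv_into V \<psi> y))) \<Longrightarrow> smooth_fun G Q f"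
  unfolding smooth_fun_def comp_def by blast

lemma smooth_fun_cong:
  assumes "openin (top_of G) Q" "\<And>x. x \<in> Q \<Longrightarrow> f x = h x" "smooth_fun G Q f"
  shows "smooth_fun G Q h"
proof (rule smooth_funI)
  fix V \<psi> assume c: "(V, \<psi>) \<in> atlas G"
  show "Cinf_on (\<psi> ` (Q \<inter> V)) (\<lambda>y. h (inv_into V \<psi> y))"
    by (rule Cinf_on_cong[OF chart_image_open[OF c assms(1)] _ smooth_funD[OF assms(3) c]])
      (use chart_image_eq[OF c] assms(2) in auto)
qed

lemma smooth_fun_subset: "smooth_fun G Q f \<Longrightarrow> Q' \<subseteq> Q \<Longrightarrow> smooth_fun G Q' f"
  by (intro smooth_funI, rule Cinf_on_subset, rule smooth_funD) auto

lemma smooth_fun_const: "smooth_fun G Q (\<lambda>x. c)"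
  by (rule smooth_funI) (rule Cinf_on_const)

lemma smooth_fun_add:
  "openin (top_of G) Q \<Longrightarrow> smooth_fun G Q f \<Longrightarrow> smooth_fun G Q h \<Longrightarrow> smooth_fun G Q (\<lambda>x. f x + h x)"
  by (rule smooth_funI, rule Cinf_on_add) (auto intro: smooth_funD chart_image_open)

lemma smooth_fun_mult:
  "openin (top_of G) Q \<Longrightarrow> smooth_fun G Q f \<Longrightarrow> smooth_fun G Q h \<Longrightarrow> smooth_fun G Q (\<lambda>x. f x * h x)"
  by (rule smooth_funI, rule Cinf_on_mult) (auto intro: smooth_funD chart_image_open)

lemma smooth_nearI: "openin (top_of G) Q \<Longrightarrow> p \<in> Q \<Longrightarrow> smooth_fun G Q f \<Longrightarrow> smooth_near G p f"
  unfolding smooth_near_def by blast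

lemma smooth_nearE:
  assumes "smooth_near G p f"
  obtains Q where "openin (top_of G) Q" "p \<in> Q" "smooth_fun G Q f"
  using assms unfolding smooth_near_def by blast

lemma smooth_near_const: "p \<in> carrier G \<Longrightarrow> smooth_near G p (\<lambda>x. c)"
  using smooth_nearI[OF openin_carrier _ smooth_fun_const] .

text \<open>Two neighbourhoods are shrunk to a common one. The rule on open sets is a parameter, so
  that sums and products share the argument.\<close>

lemma smooth_near_binop:
  assumes "\<And>Q. openin (top_of G) Q \<Longrightarrow> smooth_fun G Q f \<Longrightarrow> smooth_fun G Q h \<Longrightarrow> smooth_fun G Q k"
    and "smooth_near G p f" "smooth_near G p h"
  shows "smooth_near G p k"
proof -
  obtain A where A: "openin (top_of G) A" "p \<in> A" "smooth_fun G A f"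
    using assms(2) by (rule smooth_nearE)
  obtain B where B: "openin (top_of G) B" "p \<in> B" "smooth_fun G B h"
    using assms(3) by (rule smooth_nearE)
  have o: "openin (top_of G) (A \<inter> B)" using A B by blast
  have "smooth_fun G (A \<inter> B) k"
    by (rule assms(1)[OF o smooth_fun_subset[OF A(3)] smooth_fun_subset[OF B(3)]]) auto
  then show ?thesis using smooth_nearI[OF o] A B by blast
qed

lemma smooth_near_add: "smooth_near G p f \<Longrightarrow> smooth_near G p h \<Longrightarrow> smooth_near G p (\<lambda>x. f x + h x)"
  by (rule smooth_near_binop[OF smooth_fun_add])

lemma smooth_near_mult: "smooth_near G p f \<Longrightarrow> smooth_near G p h \<Longrightarrow> smooth_near G p (\<lambda>x. f x * h x)"
  by (rule smooth_near_binop[OF smooth_fun_mult])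

lemma smooth_near_carrier: "smooth_near G p f \<Longrightarrow> p \<in> carrier G"
  by (erule smooth_nearE) (use openin_subset_carrier in blast)

lemma smooth_near_cmult: "smooth_near G p f \<Longrightarrow> smooth_near G p (\<lambda>x. c * f x)"
  by (intro smooth_near_mult smooth_near_const smooth_near_carrier)

lemma smooth_near_sum:
  assumes "p \<in> carrier G" "finite I" "\<And>i. i \<in> I \<Longrightarrow> smooth_near G p (f i)"
  shows "smooth_near G p (\<lambda>x. \<Sum>i\<in>I. f i x)"
  using assms(2,3)
proof (induction I rule: finite_induct)
  case empty
  show ?case using smooth_near_const[OF assms(1), of 0] by simp
next
  case (insert i I)
  then show ?case using smooth_near_add[of p "f i" "\<lambda>x. \<Sum>i\<in>I. f i x"] by simp
qed

lemma smooth_near_cong: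
  assumes "openin (top_of G) Q" "p \<in> Q" "\<And>x. x \<in> Q \<Longrightarrow> f x = h x" "smooth_near G p f"
  shows "smooth_near G p h"
proof -
  obtain A where A: "openin (top_of G) A" "p \<in> A" "smooth_fun G A f"
    using assms(4) by (rule smooth_nearE)
  have o: "openin (top_of G) (A \<inter> Q)" using A assms by blast
  have "smooth_fun G (A \<inter> Q) h"
    by (rule smooth_fun_cong[OF o _ smooth_fun_subset[OF A(3)]]) (use assms(3) in auto)
  then show ?thesis using smooth_nearI[OF o] A assms by blast
qed

lemma smooth_near_carrier_cong:
  assumes "\<And>x. x \<in> carrier G \<Longrightarrow> f x = h x" "p \<in> carrier G"
  shows "smooth_near G p f \<longleftrightarrow> smooth_near G p h"
  using smooth_near_cong[OF openin_carrier assms(2), of f h]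
    smooth_near_cong[OF openin_carrier assms(2), of h f] assms(1) by metis

section \<open>Derivations at a point\<close>

lemma tangent_add:
  "v \<in> tangent_space G p \<Longrightarrow> smooth_near G p f \<Longrightarrow> smooth_near G p h \<Longrightarrow> v (\<lambda>x. f x + h x) = v f + v h"
  by (simp add: tangent_space_def plus_fun_def)

lemma tangent_mult:
  "v \<in> tangent_space G p \<Longrightarrow> smooth_near G p f \<Longrightarrow> smooth_near G p h \<Longrightarrow>
    v (\<lambda>x. f x * h x) = f p * v h + h p * v f"
  by (simp add: tangent_space_def times_fun_def)

lemma tangent_cmult:
  "v \<in> tangent_space G p \<Longrightarrow> smooth_near G p f \<Longrightarrow> v (\<lambda>x. c * f x) = c * v f"
  by (simp add: tangent_space_def scaleR_fun_def)

lemma tangent_not_smooth: "v \<in> tangent_space G p \<Longrightarrow> \<not> smooth_near G p f \<Longrightarrow> v f = 0"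
  by (simp add: tangent_space_def)

lemma tangent_spaceI:
  assumes "\<And>f h. smooth_near G p f \<Longrightarrow> smooth_near G p h \<Longrightarrow> v (\<lambda>x. f x + h x) = v f + v h"
    and "\<And>f h. smooth_near G p f \<Longrightarrow> smooth_near G p h \<Longrightarrow> v (\<lambda>x. f x * h x) = f p * v h + h p * v f"
    and "\<And>f c. smooth_near G p f \<Longrightarrow> v (\<lambda>x. c * f x) = c * v f"
    and "\<And>f. \<not> smooth_near G p f \<Longrightarrow> v f = 0"
  shows "v \<in> tangent_space G p"
  using assms by (simp add: tangent_space_def plus_fun_def times_fun_def scaleR_fun_def)

lemma subspace_tangent_space: "subspace (tangent_space G p)"
proof (rule subspaceI)
  show "0 \<in> tangent_space G p" by (rule tangent_spaceI) auto
  show "u + v \<in> tangent_space G p" if "u \<in> tangent_space G p" "v \<in> tangent_space G p" for u v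
    by (rule tangent_spaceI)
      (simp_all add: that[THEN tangent_add] that[THEN tangent_mult] that[THEN tangent_cmult]
        that[THEN tangent_not_smooth] algebra_simps)
  show "c *\<^sub>R u \<in> tangent_space G p" if "u \<in> tangent_space G p" for c u
    by (rule tangent_spaceI)
      (simp_all add: scaleR_fun_def that[THEN tangent_add] that[THEN tangent_mult]
        that[THEN tangent_cmult] that[THEN tangent_not_smooth] algebra_simps)
qed

lemma tangent_const:
  assumes "v \<in> tangent_space G p" "p \<in> carrier G"
  shows "v (\<lambda>x. c) = 0"
proof -
  have s: "smooth_near G p (\<lambda>x. 1)" by (rule smooth_near_const[OF assms(2)])
  have "v (\<lambda>x. 1) = 0" using tangent_mult[OF assms(1) s s] by simp
  then show ?thesis using tangent_cmult[OF assms(1) s, of c] by simp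
qed

lemma tangent_sum:
  assumes "v \<in> tangent_space G p" "p \<in> carrier G" "finite I" "\<And>i. i \<in> I \<Longrightarrow> smooth_near G p (f i)"
  shows "v (\<lambda>x. \<Sum>i\<in>I. f i x) = (\<Sum>i\<in>I. v (f i))"
  using assms(3,4)
proof (induction I rule: finite_induct)
  case empty
  show ?case using tangent_const[OF assms(1,2)] by simp
next
  case (insert i I)
  then show ?case
    using tangent_add[OF assms(1), of "f i" "\<lambda>x. \<Sum>i\<in>I. f i x"] smooth_near_sum[OF assms(2), of I f]
    by simp
qed

lemma tangent_cong:
  assumes v: "v \<in> tangent_space G p" and Q: "openin (top_of G) Q" "p \<in> Q"
    and eq: "\<And>x. x \<in> Q \<Longrightarrow> f x = h x"
  shows "v f = v h"
proof (cases "smooth_near G p f")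
  case True
  have p: "p \<in> carrier G" using True by (rule smooth_near_carrier)
  have h: "smooth_near G p h" by (rule smooth_near_cong[OF Q eq True])
  define d where "d = (\<lambda>x. f x + (-1) * h x)"
  \<comment> \<open>Smoothness near \<open>p\<close> concerns some neighbourhood only, and on
    \<open>Q\<close> this is the constant 1; it serves as a bump function.\<close>
  define e where "e = (\<lambda>x. if x \<in> Q then 1 else 0 :: real)"
  have d: "smooth_near G p d" unfolding d_def by (intro smooth_near_add smooth_near_cmult True h)
  have e: "smooth_near G p e"
    by (rule smooth_near_cong[OF Q _ smooth_near_const[OF p, of 1]]) (simp add: e_def)
  have "(\<lambda>x. d x * e x) = (\<lambda>x. 0)" by (auto simp: d_def e_def eq)
  then have "d p * v e + e p * v d = 0"
    using tangent_mult[OF v d e] tangent_const[OF v p, of 0] by simp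
  then have "v d = 0" using Q eq by (simp add: d_def e_def)
  then show ?thesis
    using tangent_add[OF v True smooth_near_cmult[OF h, of "-1"]] tangent_cmult[OF v h, of "-1"]
    by (simp add: d_def)
next
  \<comment> \<open>Neither function is smooth near \<open>p\<close>, so both values are the default
    0.\<close>
  case False
  then have "\<not> smooth_near G p h"
    using smooth_near_cong[OF Q, of h f] eq by metis
  then show ?thesis using False v by (simp add: tangent_not_smooth)
qed

lemma tangent_carrier_cong:
  "v \<in> tangent_space G p \<Longrightarrow> p \<in> carrier G \<Longrightarrow> (\<And>x. x \<in> carrier G \<Longrightarrow> f x = h x) \<Longrightarrow> v f = v h"
  by (rule tangent_cong[OF _ openin_carrier])

lemma chart_transition_smooth:
  assumes "(U, \<phi>) \<in> atlas G" "(V, \<psi>) \<in> atlas G"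
  shows "Cinf_on (\<phi> ` (U \<inter> V)) (\<lambda>y. \<psi> (inv_into U \<phi> y))"
proof -
  have "\<forall>(U, \<phi>)\<in>atlas G. \<forall>(V, \<psi>)\<in>atlas G. Cinf_on (\<phi> ` (U \<inter> V)) (\<psi> \<circ> inv_into U \<phi>)"
    using lie by (simp add: lie_group_def smooth_manifold_def)
  from bspec[OF bspec[OF this assms(1), unfolded prod.case] assms(2)] show ?thesis
    by (simp add: comp_def)
qed

lemma smooth_fun_chart:
  assumes c: "(U, \<phi>) \<in> atlas G" and S: "open S" and h: "Cinf_on S h"
  shows "smooth_fun G {x \<in> U. \<phi> x \<in> S} (\<lambda>x. h (\<phi> x))"
proof (rule smooth_funI)
  fix V \<psi> assume c': "(V, \<psi>) \<in> atlas G"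
  let ?Q = "{x \<in> U. \<phi> x \<in> S}"
  show "Cinf_on (\<psi> ` (?Q \<inter> V)) (\<lambda>y. h (\<phi> (inv_into V \<psi> y)))"
  proof (rule Cinf_on_compose[OF chart_image_open[OF c' chart_preimage_open[OF c S]] S _ _ h])
    show "Cinf_on (\<psi> ` (?Q \<inter> V)) (\<lambda>y. \<phi> (inv_into V \<psi> y))"
      by (rule Cinf_on_subset[OF chart_transition_smooth[OF c' c]]) auto
  qed (use chart_inv_into[OF c'] in auto)
qed

text \<open>Apply \<open>v\<close> to Hadamard's expansion: the constant is killed, and one of the
  two Leibniz terms of each product vanishes because the centred coordinate is 0 at
  \<open>p\<close>. The coefficient \<open>k b\<close> is the value of \<open>v\<close> on that
  coordinate, hence the same for all \<open>f\<close>; this uniformity is what the smoothness of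
  left invariant extensions rests on.\<close>

lemma tangent_chart:
  assumes c: "(U, \<phi>) \<in> atlas G" and p: "p \<in> U" and v: "v \<in> tangent_space G p"
  obtains k where "\<And>f. smooth_near G p f \<Longrightarrow>
    v f = (\<Sum>b\<in>Basis. k b * frechet_derivative (\<lambda>y. f (inv_into U \<phi> y)) (at (\<phi> p)) b)"
proof
  fix f assume "smooth_near G p f"
  then obtain Q where Q: "openin (top_of G) Q" "p \<in> Q" "smooth_fun G Q f" by (rule smooth_nearE)
  have pc: "p \<in> carrier G" using chart_subset[OF c] p by blast
  let ?a = "\<phi> p" and ?F = "\<lambda>y. f (inv_into U \<phi> y)"
  obtain r where r: "0 < r" "ball ?a r \<subseteq> \<phi> ` (Q \<inter> U)"
    using chart_image_open[OF c Q(1)] p Q(2) open_contains_ball by blast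
  obtain H where H: "\<And>b. Cinf_on (ball ?a (r/2)) (H b)"
    "\<And>b. H b ?a = frechet_derivative ?F (at ?a) b"
    "\<And>x. x \<in> ball ?a (r/2) \<Longrightarrow> ?F x = ?F ?a + (\<Sum>b\<in>Basis. ((x - ?a) \<bullet> b) * H b x)"
    using hadamard[OF r(1) Cinf_on_subset[OF smooth_funD[OF Q(3) c] r(2)]] by blast
  let ?Q = "{x \<in> U. \<phi> x \<in> ball ?a (r/2)}"
  let ?k = "\<lambda>b x. (\<phi> x - ?a) \<bullet> b"
  have Q': "openin (top_of G) ?Q" "p \<in> ?Q"
    using chart_preimage_open[OF c open_ball] p r(1) by (blast, simp)
  have hs: "smooth_near G p (\<lambda>x. H b (\<phi> x))" for b
    by (rule smooth_nearI[OF Q' smooth_fun_chart[OF c open_ball H(1)]])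
  have ks: "smooth_near G p (?k b)" for b
  proof (rule smooth_nearI[OF Q' smooth_fun_chart[OF c open_ball, of _ _ "\<lambda>y. (y - ?a) \<bullet> b"]])
    have "Cinf_on (ball ?a (r/2)) (\<lambda>y. (y + - ?a) \<bullet> b)"
      by (intro Cinf_on_inner Cinf_on_add Cinf_on_ident Cinf_on_const open_ball)
    then show "Cinf_on (ball ?a (r/2)) (\<lambda>y. (y - ?a) \<bullet> b)" by simp
  qed
  have "v f = v (\<lambda>x. f p + (\<Sum>b\<in>Basis. ?k b x * H b (\<phi> x)))"
  proof (rule tangent_cong[OF v Q'])
    fix x assume "x \<in> ?Q"
    then have x: "x \<in> U" "\<phi> x \<in> ball ?a (r/2)" by auto
    show "f x = f p + (\<Sum>b\<in>Basis. ?k b x * H b (\<phi> x))"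
      using H(3)[OF x(2)] by (simp only: chart_inv_into[OF c x(1)] chart_inv_into[OF c p])
  qed
  also have "\<dots> = v (\<lambda>x. f p) + v (\<lambda>x. \<Sum>b\<in>Basis. ?k b x * H b (\<phi> x))"
    by (rule tangent_add[OF v]) (intro smooth_near_const pc smooth_near_sum smooth_near_mult ks hs finite_Basis)+
  also have "\<dots> = (\<Sum>b\<in>Basis. v (\<lambda>x. ?k b x * H b (\<phi> x)))"
    by (simp add: tangent_const[OF v pc] tangent_sum[OF v pc] smooth_near_mult ks hs)
  also have "\<dots> = (\<Sum>b\<in>Basis. v (?k b) * frechet_derivative ?F (at ?a) b)"
    by (rule sum.cong[OF refl], subst tangent_mult[OF v ks hs]) (simp add: H(2) mult.commute)
  finally show "v f = (\<Sum>b\<in>Basis. v (?k b) * frechet_derivative ?F (at ?a) b)" .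
qed

section \<open>Multiplication and left translations in charts\<close>

lemma mult_domain_open:
  assumes c: "(U, \<phi>) \<in> atlas G" "(V, \<psi>) \<in> atlas G" and Q: "openin (top_of G) Q"
  shows "open {(x, y). x \<in> \<phi> ` U \<and> y \<in> \<psi> ` V \<and> inv_into U \<phi> x \<otimes> inv_into V \<psi> y \<in> Q}"
    (is "open ?D")
proof -
  let ?X = "top_of_set (\<phi> ` U \<times> \<psi> ` V)"
  \<comment> \<open>The product topology, for which multiplication is continuous, is matched with
    the Euclidean topology, in which \<open>?D\<close> has to be open.\<close>
  have X: "?X = prod_topology (top_of_set (\<phi> ` U)) (top_of_set (\<psi> ` V))"
    by (simp add: prod_topology_subtopology_eu)
  have 1: "continuous_map ?X (top_of G) (\<lambda>z. inv_into U \<phi> (fst z))"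
    unfolding X
    by (rule continuous_map_compose[OF continuous_map_fst chart_continuous_inv[OF c(1)], unfolded comp_def])
  have 2: "continuous_map ?X (top_of G) (\<lambda>z. inv_into V \<psi> (snd z))"
    unfolding X
    by (rule continuous_map_compose[OF continuous_map_snd chart_continuous_inv[OF c(2)], unfolded comp_def])
  have m: "continuous_map (prod_topology (top_of G) (top_of G)) (top_of G) (\<lambda>(a, b). a \<otimes> b)"
    using lie by (simp add: lie_group_def smooth_mult_def)
  have "continuous_map ?X (top_of G) (\<lambda>z. inv_into U \<phi> (fst z) \<otimes> inv_into V \<psi> (snd z))"
    using continuous_map_compose[OF continuous_map_pairedI[OF 1 2] m] by (simp add: comp_def)
  from openin_continuous_map_preimage[OF this Q]
  have "openin ?X {z \<in> \<phi> ` U \<times> \<psi> ` V. inv_into U \<phi> (fst z) \<otimes> inv_into V \<psi> (snd z) \<in> Q}" by simp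
  moreover have "{z \<in> \<phi> ` U \<times> \<psi> ` V. inv_into U \<phi> (fst z) \<otimes> inv_into V \<psi> (snd z) \<in> Q} = ?D" by auto
  moreover have "open (\<phi> ` U \<times> \<psi> ` V)" using c by (intro open_Times chart_open)
  ultimately show ?thesis by (simp add: openin_open_eq)
qed

text \<open>The products need not stay in a single chart. Near each point a chart \<open>W\<close>
  around the product is picked, and \<open>f\<close> is written as its expression in
  \<open>W\<close> after the smooth map \<open>\<eta> (x \<otimes> y)\<close>.\<close>

lemma smooth_fun_mult_chart:
  assumes c: "(U, \<phi>) \<in> atlas G" "(V, \<psi>) \<in> atlas G" and Q: "openin (top_of G) Q"
    and f: "smooth_fun G Q f"
  shows "Cinf_on {(x, y). x \<in> \<phi> ` U \<and> y \<in> \<psi> ` V \<and> inv_into U \<phi> x \<otimes> inv_into V \<psi> y \<in> Q}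
    (\<lambda>(x, y). f (inv_into U \<phi> x \<otimes> inv_into V \<psi> y))"
proof (rule Cinf_on_local)
  let ?D = "\<lambda>W. {(x, y). x \<in> \<phi> ` U \<and> y \<in> \<psi> ` V \<and> inv_into U \<phi> x \<otimes> inv_into V \<psi> y \<in> W}"
  let ?m = "\<lambda>(x, y). inv_into U \<phi> x \<otimes> inv_into V \<psi> y"
  fix z assume z: "z \<in> ?D Q"
  then have "?m z \<in> carrier G" using openin_subset_carrier[OF Q] by auto
  then obtain W \<eta> where W: "(W, \<eta>) \<in> atlas G" "?m z \<in> W" by (rule chart_exists)
  have o: "openin (top_of G) (Q \<inter> W)" using Q chart_openin[OF W(1)] by blast
  have "Cinf_on (?D W) (\<lambda>(x, y). \<eta> (inv_into U \<phi> x \<otimes> inv_into V \<psi> y))"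
  proof -
    have "\<forall>(U, \<phi>)\<in>atlas G. \<forall>(V, \<psi>)\<in>atlas G. \<forall>(W, \<eta>)\<in>atlas G.
       Cinf_on {(x, y). x \<in> \<phi> ` U \<and> y \<in> \<psi> ` V \<and> inv_into U \<phi> x \<otimes> inv_into V \<psi> y \<in> W}
         (\<lambda>(x, y). \<eta> (inv_into U \<phi> x \<otimes> inv_into V \<psi> y))"
      using lie by (simp add: lie_group_def smooth_mult_def)
    from bspec[OF bspec[OF bspec[OF this c(1), unfolded prod.case] c(2), unfolded prod.case] W(1)]
    show ?thesis by simp
  qed
  then have "Cinf_on (?D W) (\<lambda>z. \<eta> (?m z))" by (simp add: case_prod_unfold)
  then have m: "Cinf_on (?D (Q \<inter> W)) (\<lambda>z. \<eta> (?m z))" by (rule Cinf_on_subset) auto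
  have "Cinf_on (?D (Q \<inter> W)) (\<lambda>z. f (inv_into W \<eta> (\<eta> (?m z))))"
    by (rule Cinf_on_compose[OF mult_domain_open[OF c o] chart_image_open[OF W(1) Q] _ m
          smooth_funD[OF f W(1)]]) auto
  then have "Cinf_on (?D (Q \<inter> W)) (\<lambda>(x, y). f (inv_into U \<phi> x \<otimes> inv_into V \<psi> y))"
    by (rule Cinf_on_cong[OF mult_domain_open[OF c o], rotated]) (auto simp: chart_inv_into[OF W(1)])
  then show "\<exists>T. open T \<and> z \<in> T \<and> Cinf_on T (\<lambda>(x, y). f (inv_into U \<phi> x \<otimes> inv_into V \<psi> y))"
    using mult_domain_open[OF c o] z W(2) by (intro exI[of _ "?D (Q \<inter> W)"]) auto
qed

lemma left_translate_openin:
  assumes a: "a \<in> carrier G" and Q: "openin (top_of G) Q"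
  shows "openin (top_of G) {x \<in> carrier G. a \<otimes> x \<in> Q}"
proof -
  have m: "continuous_map (prod_topology (top_of G) (top_of G)) (top_of G) (\<lambda>(a, b). a \<otimes> b)"
    using lie by (simp add: lie_group_def smooth_mult_def)
  have "continuous_map (top_of G) (top_of G) (\<lambda>x. a \<otimes> x)"
    using continuous_map_compose[OF continuous_map_pairedI[of "top_of G" "top_of G" "\<lambda>x. a" "top_of G" "\<lambda>x. x"] m] a
    by (simp add: comp_def topspace_eq)
  from openin_continuous_map_preimage[OF this Q] show ?thesis by (simp add: topspace_eq)
qed

lemma smooth_fun_left_translate:
  assumes a: "a \<in> carrier G" and Q: "openin (top_of G) Q" and f: "smooth_fun G Q f"
  shows "smooth_fun G {x \<in> carrier G. a \<otimes> x \<in> Q} (\<lambda>x. f (a \<otimes> x))"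
proof (rule smooth_funI)
  fix V \<psi> assume c: "(V, \<psi>) \<in> atlas G"
  obtain U \<phi> where U: "(U, \<phi>) \<in> atlas G" "a \<in> U" using a by (rule chart_exists)
  let ?Q = "{x \<in> carrier G. a \<otimes> x \<in> Q}"
  let ?H = "\<lambda>(x, y). f (inv_into U \<phi> x \<otimes> inv_into V \<psi> y)"
  have o: "open (\<psi> ` (?Q \<inter> V))" by (rule chart_image_open[OF c left_translate_openin[OF a Q]])
  \<comment> \<open>Left translation is multiplication with the first coordinate frozen at
    \<open>\<phi> a\<close>.\<close>
  have "Cinf_on (\<psi> ` (?Q \<inter> V)) (\<lambda>y. ?H (\<phi> a, y))"
    by (rule Cinf_on_compose[OF o mult_domain_open[OF U(1) c Q] _ _ smooth_fun_mult_chart[OF U(1) c Q f]])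
      (use U c in \<open>auto intro!: Cinf_on_Pair Cinf_on_const Cinf_on_ident o simp: chart_inv_into\<close>)
  then show "Cinf_on (\<psi> ` (?Q \<inter> V)) (\<lambda>y. f (a \<otimes> inv_into V \<psi> y))"
    by (simp add: chart_inv_into[OF U])
qed

text \<open>Both directions matter: tangent vectors take the value 0 on functions that are not
  smooth near the point, so translation has to preserve non-smoothness as well.\<close>

lemma smooth_near_left_translate:
  assumes a: "a \<in> carrier G" and p: "p \<in> carrier G"
  shows "smooth_near G p (\<lambda>x. f (a \<otimes> x)) \<longleftrightarrow> smooth_near G (a \<otimes> p) f"
proof -
  have *: "smooth_near G q (\<lambda>x. h (b \<otimes> x))"
    if b: "b \<in> carrier G" and q: "q \<in> carrier G" and h: "smooth_near G (b \<otimes> q) h" for b q h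
  proof -
    obtain Q where Q: "openin (top_of G) Q" "b \<otimes> q \<in> Q" "smooth_fun G Q h"
      using h by (rule smooth_nearE)
    show ?thesis
      by (rule smooth_nearI[OF left_translate_openin[OF b Q(1)] _
            smooth_fun_left_translate[OF b Q(1,3)]]) (use q Q in auto)
  qed
  \<comment> \<open>The converse direction translates back by \<open>inv a\<close>. The resulting
    function agrees with \<open>f\<close> on the carrier, which is all that smoothness sees.\<close>
  have "smooth_near G (a \<otimes> p) (\<lambda>x. f (a \<otimes> (inv a \<otimes> x)))" if "smooth_near G p (\<lambda>x. f (a \<otimes> x))"
    using *[of "inv a" "a \<otimes> p" "\<lambda>x. f (a \<otimes> x)"] that a p by (simp add: m_assoc[symmetric])
  moreover have "smooth_near G (a \<otimes> p) (\<lambda>x. f (a \<otimes> (inv a \<otimes> x))) \<longleftrightarrow> smooth_near G (a \<otimes> p) f"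
    by (rule smooth_near_carrier_cong) (use a p in \<open>auto simp: m_assoc[symmetric]\<close>)
  ultimately show ?thesis using *[OF a p] by blast
qed

lemma left_push_tangent:
  assumes "a \<in> carrier G" "p \<in> carrier G" "v \<in> tangent_space G p"
  shows "left_push G a v \<in> tangent_space G (a \<otimes> p)"
  by (rule tangent_spaceI)
    (simp_all add: left_push_def smooth_near_left_translate[OF assms(1,2), symmetric]
      assms(3)[THEN tangent_add] assms(3)[THEN tangent_mult] assms(3)[THEN tangent_cmult]
      assms(3)[THEN tangent_not_smooth])

section \<open>Left invariant fields with a given value at the identity\<close>

definition left_extension :: "'a tangent_vector \<Rightarrow> 'a vector_field" where
  "left_extension v = (\<lambda>p. if p \<in> carrier G then left_push G p v else 0)"

text \<open>By \<open>tangent_chart\<close> the value at \<open>p\<close> is a combination, with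
  coefficients \<open>k\<close> independent of \<open>p\<close>, of partial derivatives of
  \<open>x \<mapsto> f (p \<otimes> x)\<close> at \<open>\<one>\<close>. These are derivatives of
  the jointly smooth map \<open>(p, x) \<mapsto> f (p \<otimes> x)\<close> in the directions
  \<open>(0, b)\<close>, so they vary smoothly with \<open>p\<close>.\<close>

lemma left_extension_smooth:
  assumes v: "v \<in> tangent_space G \<one>" and Q: "openin (top_of G) Q" and f: "smooth_fun G Q f"
  shows "smooth_fun G Q (\<lambda>p. left_extension v p f)"
proof (rule smooth_funI)
  fix V \<psi> assume c: "(V, \<psi>) \<in> atlas G"
  obtain U \<phi> where U: "(U, \<phi>) \<in> atlas G" "\<one> \<in> U" using one_closed by (rule chart_exists)
  obtain k where k: "\<And>f. smooth_near G \<one> f \<Longrightarrow>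
    v f = (\<Sum>b\<in>Basis. k b * frechet_derivative (\<lambda>y. f (inv_into U \<phi> y)) (at (\<phi> \<one>)) b)"
    using tangent_chart[OF U v] by blast
  let ?D = "{(y, x). y \<in> \<psi> ` V \<and> x \<in> \<phi> ` U \<and> inv_into V \<psi> y \<otimes> inv_into U \<phi> x \<in> Q}"
  let ?H = "\<lambda>(y, x). f (inv_into V \<psi> y \<otimes> inv_into U \<phi> x)"
  let ?S = "\<psi> ` (Q \<inter> V)"
  have o: "open ?S" by (rule chart_image_open[OF c Q])
  have H: "Cinf_on ?D ?H" by (rule smooth_fun_mult_chart[OF c U(1) Q f])
  have D: "(y, \<phi> \<one>) \<in> ?D" if "y \<in> ?S" for y
    using that U c openin_subset_carrier[OF Q] by (auto simp: chart_inv_into)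
  have e: "Cinf_on ?S (\<lambda>y. \<Sum>b\<in>Basis. k b * frechet_derivative ?H (at (y, \<phi> \<one>)) (0, b))"
  proof (intro Cinf_on_sum Cinf_on_mult Cinf_on_const o)
    show "Cinf_on ?S (\<lambda>y. frechet_derivative ?H (at (y, \<phi> \<one>)) (0, b))" for b
      by (rule Cinf_on_compose[OF o mult_domain_open[OF c U(1) Q] D _ Cinf_on_frechet_derivative[OF H]])
        (auto intro!: Cinf_on_Pair Cinf_on_const Cinf_on_ident o)
  qed
  show "Cinf_on ?S (\<lambda>y. left_extension v (inv_into V \<psi> y) f)"
  proof (rule Cinf_on_cong[OF o _ e])
    fix y assume y: "y \<in> ?S"
    let ?p = "inv_into V \<psi> y"
    have p: "?p \<in> Q" "?p \<in> carrier G"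
      using y c openin_subset_carrier[OF Q] by (auto simp: chart_inv_into)
    have s: "smooth_near G \<one> (\<lambda>x. f (?p \<otimes> x))"
      using smooth_near_left_translate[OF p(2) one_closed, of f] smooth_nearI[OF Q p(1) f] p(2) by simp
    have "((\<lambda>x. (y, x)) has_derivative (\<lambda>w. (0, w))) (at (\<phi> \<one>))"
      by (auto intro!: derivative_eq_intros)
    from has_derivative_compose[OF this Cinf_on_has_derivative[OF H D[OF y]]]
    have "frechet_derivative (\<lambda>x. f (?p \<otimes> inv_into U \<phi> x)) (at (\<phi> \<one>))
        = (\<lambda>w. frechet_derivative ?H (at (y, \<phi> \<one>)) (0, w))"
      using frechet_derivative_at by fastforce
    then show "(\<Sum>b\<in>Basis. k b * frechet_derivative ?H (at (y, \<phi> \<one>)) (0, b)) = left_extension v ?p f"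
      using k[OF s] p(2) by (simp add: left_extension_def left_push_def)
  qed
qed

lemma left_extension_in_lie_algebra:
  assumes v: "v \<in> tangent_space G \<one>"
  shows "left_extension v \<in> lie_algebra G"
proof -
  have "left_extension v p \<in> tangent_space G p" if "p \<in> carrier G" for p
    using left_push_tangent[OF that one_closed v] that by (simp add: left_extension_def)
  then have "left_extension v \<in> vector_fields G"
    using left_extension_smooth[OF v] by (simp add: vector_fields_def left_extension_def)
  moreover have "left_extension v (a \<otimes> p) = left_push G a (left_extension v p)"
    if "a \<in> carrier G" "p \<in> carrier G" for a p
    using that
    by (auto simp: left_extension_def left_push_def m_assoc
        intro!: ext tangent_carrier_cong[OF v one_closed])
  ultimately show ?thesis by (simp add: lie_algebra_def)
qed

lemma left_extension_one:
  assumes v: "v \<in> tangent_space G \<one>"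
  shows "left_extension v \<one> = v"
  by (auto simp: left_extension_def left_push_def intro!: ext tangent_carrier_cong[OF v one_closed])

lemma lie_algebra_vector_field: "X \<in> lie_algebra G \<Longrightarrow> X \<in> vector_fields G"
  by (simp add: lie_algebra_def)

lemma vector_field_tangent: "X \<in> vector_fields G \<Longrightarrow> p \<in> carrier G \<Longrightarrow> X p \<in> tangent_space G p"
  by (simp add: vector_fields_def)

text \<open>Invariance under translation by \<open>p\<close> recovers \<open>X p\<close> from
  \<open>X \<one>\<close>. Evaluation at the identity thus identifies the Lie algebra with the
  tangent space there, with \<open>left_extension\<close> as inverse.\<close>

lemma left_extension_eval:
  assumes "X \<in> lie_algebra G"
  shows "left_extension (X \<one>) = X"
proof
  fix p
  have "X (p \<otimes> \<one>) = left_push G p (X \<one>)" if "p \<in> carrier G"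
    using assms that one_closed unfolding lie_algebra_def by blast
  then show "left_extension (X \<one>) p = X p"
    using assms by (simp add: left_extension_def lie_algebra_def vector_fields_def)
qed

lemma lie_algebra_eqI: "X \<in> lie_algebra G \<Longrightarrow> Y \<in> lie_algebra G \<Longrightarrow> X \<one> = Y \<one> \<Longrightarrow> X = Y"
  using left_extension_eval by metis

lemma left_push_add: "left_push G a (u + v) = left_push G a u + left_push G a v"
  by (auto simp: left_push_def)

lemma left_push_scaleR: "left_push G a (c *\<^sub>R u) = c *\<^sub>R left_push G a u"
  by (auto simp: left_push_def scaleR_fun_def)

section \<open>The Lie algebra, its bracket and the action of \<open>J\<close>\<close>

lemma subspace_vector_fields: "subspace (vector_fields G)"
proof (rule subspaceI)
  show "0 \<in> vector_fields G"
    by (auto simp: vector_fields_def subspace_0[OF subspace_tangent_space] smooth_fun_const)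
  show "X + Y \<in> vector_fields G" if "X \<in> vector_fields G" "Y \<in> vector_fields G" for X Y
    using that by (auto simp: vector_fields_def subspace_add[OF subspace_tangent_space] intro: smooth_fun_add)
  show "c *\<^sub>R X \<in> vector_fields G" if "X \<in> vector_fields G" for c X
    using that subspace_scale[OF subspace_tangent_space]
    by (auto simp: vector_fields_def scaleR_fun_def intro: smooth_fun_mult smooth_fun_const)
qed

lemma subspace_lie_algebra: "subspace (lie_algebra G)"
proof (rule subspaceI)
  show "0 \<in> lie_algebra G"
    using subspace_0[OF subspace_vector_fields] by (auto simp: lie_algebra_def left_push_def)
  show "X + Y \<in> lie_algebra G" if "X \<in> lie_algebra G" "Y \<in> lie_algebra G" for X Y
    using that subspace_add[OF subspace_vector_fields] by (simp add: lie_algebra_def left_push_add)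
  show "c *\<^sub>R X \<in> lie_algebra G" if "X \<in> lie_algebra G" for c X
  proof -
    have "(c *\<^sub>R X) (a \<otimes> p) = left_push G a ((c *\<^sub>R X) p)"
      if "a \<in> carrier G" "p \<in> carrier G" for a p
      using that \<open>X \<in> lie_algebra G\<close>
      by (simp add: lie_algebra_def left_push_scaleR scaleR_fun_def[of c X])
    then show ?thesis
      using that subspace_scale[OF subspace_vector_fields] by (simp add: lie_algebra_def)
  qed
qed

text \<open>Both iterated derivatives are moved from \<open>a \<otimes> p\<close> to
  \<open>p\<close>. Smoothness of the bracket is a separate matter, settled later by
  torsion-freeness, which writes it as a difference of two covariant derivatives.\<close>

lemma lie_bracket_left_invariant:
  assumes X: "X \<in> lie_algebra G" and Y: "Y \<in> lie_algebra G" and a: "a \<in> carrier G" and p: "p \<in> carrier G"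
  shows "lie_bracket G X Y (a \<otimes> p) = left_push G a (lie_bracket G X Y p)"
proof
  fix f
  have inv: "Z (a \<otimes> p) (\<lambda>q. W q f) = Z p (\<lambda>q. W q (\<lambda>x. f (a \<otimes> x)))"
    if Z: "Z \<in> lie_algebra G" and W: "W \<in> lie_algebra G" for Z W
  proof -
    have "Z (a \<otimes> p) (\<lambda>q. W q f) = Z p (\<lambda>q. W (a \<otimes> q) f)"
      using Z a p by (simp add: lie_algebra_def left_push_def)
    also have "\<dots> = Z p (\<lambda>q. W q (\<lambda>x. f (a \<otimes> x)))"
      by (rule tangent_carrier_cong[OF vector_field_tangent[OF lie_algebra_vector_field[OF Z] p] p])
        (use W a in \<open>simp add: lie_algebra_def left_push_def\<close>)
    finally show ?thesis .
  qed
  show "lie_bracket G X Y (a \<otimes> p) f = left_push G a (lie_bracket G X Y p) f"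
    using a p inv[OF X Y] inv[OF Y X] smooth_near_left_translate[OF a p, of f]
    by (simp add: lie_bracket_def left_push_def)
qed

lemma apply_endo_in_lie_algebra:
  assumes J: "almost_complex G J" "left_invariant_endo G J" and X: "X \<in> lie_algebra G"
  shows "apply_endo G J X \<in> lie_algebra G"
proof -
  have "J (a \<otimes> p) (X (a \<otimes> p)) = left_push G a (J p (X p))" if "a \<in> carrier G" "p \<in> carrier G" for a p
    using J(2) X that vector_field_tangent[OF lie_algebra_vector_field[OF X]]
    by (simp add: left_invariant_endo_def lie_algebra_def)
  moreover have "apply_endo G J X \<in> vector_fields G"
    using J(1) lie_algebra_vector_field[OF X] by (simp add: almost_complex_def)
  ultimately show ?thesis by (simp add: lie_algebra_def apply_endo_def)
qed

section \<open>From the Levi-Civita connection to algebra at the identity\<close>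

lemma unimodular_if_abelian_anti_kaehler:
  assumes K: "left_invariant_anti_kaehler G g J" and abel: "abelian_complex G J"
  shows "unimodular G"
proof -
  let ?L = "lie_algebra G" and ?J = "apply_endo G J"
  have pr: "pseudo_riemannian G g" and gi: "left_invariant_metric G g"
    and ac: "almost_complex G J" and Ji: "left_invariant_endo G J"
    and gJ: "\<And>p u v. p \<in> carrier G \<Longrightarrow> u \<in> tangent_space G p \<Longrightarrow> v \<in> tangent_space G p \<Longrightarrow>
      g p (J p u) (J p v) = - g p u v"
    using K by (auto simp: left_invariant_anti_kaehler_def)
  obtain D where lc: "levi_civita G g D" and par: "parallel_endo G D J"
    using K by (auto simp: left_invariant_anti_kaehler_def)
  have aff: "affine_connection G D" using lc by (simp add: levi_civita_def)
  \<comment> \<open>The field \<open>D X Y\<close> is known only to be smooth, so it is replaced by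
    the left invariant field with the same value at the identity. The laws of the locale are linear
    identities, equations between left invariant fields, or equations at \<open>\<one>\<close>, and
    pass from \<open>D\<close> to \<open>?N\<close>.\<close>
  let ?N = "\<lambda>X Y. left_extension (D X Y \<one>)"
  note vf = lie_algebra_vector_field
  note tan1 = vector_field_tangent[OF vf one_closed]
  have Dvf: "D X Y \<in> vector_fields G" if "X \<in> ?L" "Y \<in> ?L" for X Y
    using aff that vf by (simp add: affine_connection_def)
  have Dtan: "D X Y \<one> \<in> tangent_space G \<one>" if "X \<in> ?L" "Y \<in> ?L" for X Y
    using vector_field_tangent[OF Dvf[OF that] one_closed] .
  have NL: "?N X Y \<in> ?L" if "X \<in> ?L" "Y \<in> ?L" for X Y
    by (rule left_extension_in_lie_algebra[OF Dtan[OF that]])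
  have N1: "?N X Y \<one> = D X Y \<one>" if "X \<in> ?L" "Y \<in> ?L" for X Y
    by (rule left_extension_one[OF Dtan[OF that]])
  have JL: "?J X \<in> ?L" if "X \<in> ?L" for X by (rule apply_endo_in_lie_algebra[OF ac Ji that])
  have J1: "?J X \<one> = J \<one> (X \<one>)" for X by (simp add: apply_endo_def)
  have ext_add: "left_extension (u + v) = left_extension u + left_extension v" for u v
    by (auto simp: left_extension_def left_push_add)
  have ext_scaleR: "left_extension (c *\<^sub>R u) = c *\<^sub>R left_extension u" for c u
    by (rule ext) (simp add: left_extension_def left_push_scaleR scaleR_fun_apply)
  have D_scaleR: "D (c *\<^sub>R X) Y = c *\<^sub>R D X Y" "D X (c *\<^sub>R Y) = c *\<^sub>R D X Y"
    if "X \<in> ?L" "Y \<in> ?L" for c X Y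
  proof -
    \<comment> \<open>The derivative term in the Leibniz rule for the constant function
      \<open>c\<close>. Off the carrier it vanishes because \<open>X p = 0\<close> there.\<close>
    have "X p (\<lambda>_. c) = 0" for p
      using tangent_const[OF vector_field_tangent[OF vf[OF that(1)]]] vf[OF that(1)]
      by (cases "p \<in> carrier G") (auto simp: vector_fields_def)
    then show "D (c *\<^sub>R X) Y = c *\<^sub>R D X Y" "D X (c *\<^sub>R Y) = c *\<^sub>R D X Y"
      using aff that vf smooth_fun_const[of "carrier G" c]
      by (simp_all add: affine_connection_def scaleR_fun_def[of c X] scaleR_fun_def[of c Y]
          scaleR_fun_def[of c "D X Y"])
  qed
  have bracket: "lie_bracket G X Y = D X Y - D Y X" if "X \<in> ?L" "Y \<in> ?L" for X Y
    using lc that vf by (simp add: levi_civita_def)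
  have brL: "lie_bracket G X Y \<in> ?L" if "X \<in> ?L" "Y \<in> ?L" for X Y
    using that lie_bracket_left_invariant subspace_diff[OF subspace_vector_fields Dvf Dvf]
    by (simp add: lie_algebra_def bracket)
  \<comment> \<open>This constancy is what removes the derivative term from metric
    compatibility.\<close>
  have gconst: "g p (X p) (Y p) = g \<one> (X \<one>) (Y \<one>)"
    if "X \<in> ?L" "Y \<in> ?L" "p \<in> carrier G" for X Y p
  proof -
    have "g (p \<otimes> \<one>) (left_push G p (X \<one>)) (left_push G p (Y \<one>)) = g \<one> (X \<one>) (Y \<one>)"
      using gi that(3) one_closed tan1[OF that(1)] tan1[OF that(2)]
      unfolding left_invariant_metric_def by blast
    moreover have "left_push G p (Z \<one>) = Z p" if "Z \<in> ?L" for Z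
      using left_extension_eval[OF that] \<open>p \<in> carrier G\<close> by (metis left_extension_def)
    ultimately show ?thesis using that by simp
  qed
  interpret anti_kaehler_abelian ?L "\<lambda>X Y. g \<one> (X \<one>) (Y \<one>)" ?J ?N "lie_bracket G"
  proof
    show "g \<one> (X \<one>) (Y \<one>) = g \<one> (Y \<one>) (X \<one>)" if "X \<in> ?L" "Y \<in> ?L" for X Y
      using pr tan1 that by (simp add: pseudo_riemannian_def)
    show "g \<one> ((X + Y) \<one>) (Z \<one>) = g \<one> (X \<one>) (Z \<one>) + g \<one> (Y \<one>) (Z \<one>)"
      if "X \<in> ?L" "Y \<in> ?L" "Z \<in> ?L" for X Y Z
      using pr tan1 that by (simp add: pseudo_riemannian_def)
    show "g \<one> ((c *\<^sub>R X) \<one>) (Z \<one>) = c * g \<one> (X \<one>) (Z \<one>)" if "X \<in> ?L" "Z \<in> ?L" for c X Z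
      using pr tan1 that by (simp add: pseudo_riemannian_def scaleR_fun_def[of c X])
    show "X = 0" if X: "X \<in> ?L" and 0: "\<And>Y. Y \<in> ?L \<Longrightarrow> g \<one> (X \<one>) (Y \<one>) = 0" for X
    proof -
      have "\<forall>w\<in>tangent_space G \<one>. g \<one> (X \<one>) w = 0"
        using 0[OF left_extension_in_lie_algebra] left_extension_one by simp
      moreover have "\<forall>u\<in>tangent_space G \<one>. (\<forall>w\<in>tangent_space G \<one>. g \<one> u w = 0) \<longrightarrow> u = 0"
        using pr one_closed unfolding pseudo_riemannian_def by blast
      ultimately have "X \<one> = 0" using tan1[OF X] by blast
      then show ?thesis
        using lie_algebra_eqI[OF X subspace_0[OF subspace_lie_algebra]] by simp
    qed
    show "?J (X + Y) = ?J X + ?J Y" if "X \<in> ?L" "Y \<in> ?L" for X Y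
      using ac vector_field_tangent[OF vf] that
      by - (rule ext, simp add: apply_endo_def almost_complex_def)
    show "?J (c *\<^sub>R X) = c *\<^sub>R ?J X" if "X \<in> ?L" for c X
      using ac vector_field_tangent[OF vf] that
      by - (rule ext, simp add: apply_endo_def almost_complex_def scaleR_fun_apply)
    show "?J (?J X) = - X" if "X \<in> ?L" for X
      using ac vector_field_tangent[OF vf] vf[OF that] that
      by - (rule ext, simp add: apply_endo_def almost_complex_def vector_fields_def)
    show "g \<one> (?J X \<one>) (?J Y \<one>) = - g \<one> (X \<one>) (Y \<one>)" if "X \<in> ?L" "Y \<in> ?L" for X Y
      using gJ tan1 that by (simp add: J1)
    show "?N (X + Y) Z = ?N X Z + ?N Y Z" "?N X (Y + Z) = ?N X Y + ?N X Z"
      if "X \<in> ?L" "Y \<in> ?L" "Z \<in> ?L" for X Y Z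
      using aff that vf by (simp_all add: affine_connection_def flip: ext_add)
    show "?N (c *\<^sub>R X) Y = c *\<^sub>R ?N X Y" "?N X (c *\<^sub>R Y) = c *\<^sub>R ?N X Y"
      if "X \<in> ?L" "Y \<in> ?L" for c X Y
      using that by (simp_all add: D_scaleR scaleR_fun_def[of c "D X Y"] flip: ext_scaleR)
    show "lie_bracket G X Y = ?N X Y - ?N Y X" if "X \<in> ?L" "Y \<in> ?L" for X Y
    proof (rule lie_algebra_eqI[OF brL[OF that]])
      show "?N X Y - ?N Y X \<in> ?L" using that NL subspace_diff[OF subspace_lie_algebra] by blast
      show "lie_bracket G X Y \<one> = (?N X Y - ?N Y X) \<one>" using that by (simp add: bracket N1)
    qed
    show "g \<one> (?N X Y \<one>) (Z \<one>) + g \<one> (Y \<one>) (?N X Z \<one>) = 0"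
      if "X \<in> ?L" "Y \<in> ?L" "Z \<in> ?L" for X Y Z
    proof -
      have "X \<one> (\<lambda>q. g q (Y q) (Z q)) = X \<one> (\<lambda>q. g \<one> (Y \<one>) (Z \<one>))"
        by (rule tangent_carrier_cong[OF tan1[OF that(1)] one_closed]) (rule gconst[OF that(2,3)])
      then have "X \<one> (\<lambda>q. g q (Y q) (Z q)) = 0"
        using tangent_const[OF tan1[OF that(1)] one_closed] by simp
      then show ?thesis using lc that vf by (simp add: levi_civita_def N1)
    qed
    show "?N X (?J Y) = ?J (?N X Y)" if "X \<in> ?L" "Y \<in> ?L" for X Y
    proof (rule lie_algebra_eqI[OF NL[OF that(1) JL[OF that(2)]] JL[OF NL[OF that]]])
      \<comment> \<open>Although \<open>D X Y\<close> and \<open>?N X Y\<close> may be different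
        fields, \<open>J\<close> acts pointwise, so their images under \<open>?J\<close> agree at
        the identity.\<close>
      have "D X (?J Y) = ?J (D X Y)" using par that vf by (simp add: parallel_endo_def)
      then have "?N X (?J Y) \<one> = J \<one> (D X Y \<one>)"
        using N1[OF that(1) JL[OF that(2)]] by (metis J1)
      also have "\<dots> = ?J (?N X Y) \<one>" by (simp only: J1 N1[OF that])
      finally show "?N X (?J Y) \<one> = ?J (?N X Y) \<one>" .
    qed
    show "lie_bracket G (?J X) (?J Y) = lie_bracket G X Y" if "X \<in> ?L" "Y \<in> ?L" for X Y
      using abel that by (simp add: abelian_complex_def)
  qed (fact subspace_lie_algebra JL NL)+
  show ?thesis using trace_on_br_eq_0 by (simp add: unimodular_def)
qed

end

theorem proposition4p3:
  fixes G :: "('a, 'e::euclidean_space) charted_group"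
    and g :: "'a metric_tensor"
    and J :: "'a endo_field"
    and n :: nat
  assumes "lie_group G"
    and "DIM('e) = 2 * n"
    and "left_invariant_anti_kaehler G g J"
    and "abelian_complex G J"
  shows "unimodular G"
proof -
  interpret lie_group_loc G by unfold_locales (fact assms(1))
  show ?thesis by (rule unimodular_if_abelian_anti_kaehler[OF assms(3,4)])
qed

end
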